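(* Let $M\in\mathbb N$ and $\mathcal A\subset\{0,\dots,M-1\}$ with $1<|\mathcal A|<M$, and put $\delta=\log|\mathcal A|/\log M\in(0,1)$. Then there exists $\beta=\beta(M,\mathcal A)$, depending only on $M$ and $\mathcal A$, with $$\beta>\max\Big(0,\frac12-\delta\Big)$$ such that for every cutoff $\chi\in C_0^\infty((0,1);[0,1])$ the open quantum baker's maps $B_N=B_{N,\chi}$, $N=M^k$, $k\in\mathbb N$, satisfy $$\limsup_{N\to\infty}\max\{|\lambda|\colon \lambda\in\mathrm{Sp}(B_N)\}\le M^{-\beta},$$ where the limit is taken along $N=M^k$, $k\to\infty$, and $\mathrm{Sp}$ denotes the spectrum.
   Context: $\mathbb Z_N=\mathbb Z/N\mathbb Z\simeq\{0,\dots,N-1\}$; $\ell^2_N$ is the space of functions $u:\mathbb Z_N\to\mathbb C$ with $\|u\|_{\ell^2_N}^2=\sum_{j=0}^{N-1}|u(j)|^2$. The unitary Fourier transform is $\mathcal F_Nu(j)=\frac1{\sqrt N}\sum_{\ell=0}^{N-1}\exp(-2\pi ij\ell/N)u(\ell)$. For $\chi\in C_0^\infty((0,1);[0,1])$ (extended by zero), $\chi_N$ is the multiplication operator on $\ell^2_N$ by $\chi_N(j)=\chi(j/N)$, $j\in\{0,\dots,N-1\}$. Open quantum baker's map: for $N=M^k$, $k\in\mathbb N$, and $a\in\{0,\dots,M-1\}$, let $\Pi_a:\ell^2_N\to\ell^2_{N/M}$, $\Pi_au(j)=u(j+aN/M)$ for $j\in\{0,\dots,N/M-1\}$. Then $$B_N=B_{N,\chi}=\sum_{a\in\mathcal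 A}\mathcal F_N^*\,\Pi_a^*\,\chi_{N/M}\,\mathcal F_{N/M}\,\chi_{N/M}\,\Pi_a:\ell^2_N\to\ell^2_N.$$ *)

theory Defs
  imports
    "HOL-Analysis.Analysis"
    "Jordan_Normal_Form.Schur_Decomposition"
    "Jordan_Normal_Form.Spectral_Radius"
begin

text \<open>
  Functions on \<open>{0, \<dots>, N - 1}\<close> with the counting \<open>\<ell>\<^sup>2\<close> norm are represented by complex vectors
  of dimension \<open>N\<close>, and operators between such spaces by their matrices in the standard
  (orthonormal) bases. Operator adjoints are therefore conjugate transposes, i.e. \<open>mat_adjoint\<close>.
\<close>

text \<open>
  \<open>C\<^sub>0\<^sup>\<infinity>((0,1);[0,1])\<close>, each function being identified with its extension by zero to the real line.
  The support is closed in the real line, so its inclusion in \<open>(0,1)\<close> makes it compact.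
\<close>

definition smooth_cutoff :: "(real \<Rightarrow> real) \<Rightarrow> bool" where
  "smooth_cutoff chi \<longleftrightarrow>
     (\<forall>n x. ((deriv ^^ n) chi) field_differentiable (at x)) \<and>
     closure {x. chi x \<noteq> 0} \<subseteq> {0<..<1} \<and>
     (\<forall>x. chi x \<in> {0..1})"

definition fourier_mat :: "nat \<Rightarrow> complex mat" where
  "fourier_mat N = Matrix.mat N N (\<lambda>(j, l).
     exp (- 2 * of_real pi * \<i> * of_nat j * of_nat l / of_nat N) / of_real (sqrt (real N)))"

definition cutoff_mat :: "(real \<Rightarrow> real) \<Rightarrow> nat \<Rightarrow> complex mat" where
  "cutoff_mat chi N = mat_diag N (\<lambda>j. of_real (chi (real j / real N)))"

text \<open>
  The matrix of the map \<open>\<Pi>\<^sub>a u(j) = u(j + a N / M)\<close> from dimension \<open>N\<close> to dimension \<open>N / M\<close>.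
  Here and below, \<open>N div M\<close> is the exact quotient when \<open>N = M ^ k\<close> with \<open>k \<ge> 1\<close>.
\<close>

definition block_proj_mat :: "nat \<Rightarrow> nat \<Rightarrow> nat \<Rightarrow> complex mat" where
  "block_proj_mat M N a = Matrix.mat (N div M) N (\<lambda>(j, l).
     if l = j + a * (N div M) then 1 else 0)"

text \<open>
  The type of matrices of all sizes has no zero element for \<open>sum\<close>,
  so the sum over the alphabet is taken entrywise.
\<close>

definition baker_mat :: "nat \<Rightarrow> nat set \<Rightarrow> (real \<Rightarrow> real) \<Rightarrow> nat \<Rightarrow> complex mat" where
  "baker_mat M A chi N = Matrix.mat N N (\<lambda>(i, j). \<Sum>a\<in>A.
     (mat_adjoint (fourier_mat N) * mat_adjoint (block_proj_mat M N a) *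
      cutoff_mat chi (N div M) * fourier_mat (N div M) * cutoff_mat chi (N div M) *
      block_proj_mat M N a) $$ (i, j))"

end

theory Submission
  imports Defs
begin

text \<open>
  Let \<open>N = M\<^sup>k\<close> and let \<open>\<C>\<^sub>k\<close> be the set of \<open>j < N\<close> all of whose base-\<open>M\<close> digits lie in \<open>A\<close>. The bound
  rests on a fractal uncertainty principle (no function is concentrated on \<open>\<C>\<^sub>k\<close> together with its
  Fourier transform) and on the localization of eigenvectors near \<open>\<C>\<^sub>k\<close> in both representations.
  
  \<^bold>\<open>Uncertainty.\<close> Let \<open>R\<^sub>k\<close> bound the squared norm of \<open>1\<^bsub>\<C>\<^sub>k\<^esub> \<surd>N F\<^sub>N\<^sup>* 1\<^bsub>\<C>\<^sub>k\<^esub>\<close>. Writing one variable as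
  \<open>M\<^bsup>k1\<^esup> a + b\<close> and the other as \<open>M\<^bsup>k2\<^esup> c + d\<close> removes the product \<open>ac\<close> from the phase, so that the kernel
  factors and bounds multiply: \<open>R\<^bsub>k1+k2\<^esub> \<le> R\<^bsub>k1\<^esub> R\<^bsub>k2\<^esub>\<close> (\<open>uncertainty_bound_mult\<close>). There are two
  trivial bounds, \<open>M\<^sup>k\<close> by Parseval and \<open>|A|\<^bsup>2k\<^esup>\<close> by Cauchy-Schwarz, and it suffices to beat both at
  one scale (\<open>ex_strict_scale\<close>). Equality in the first would make a nonzero function on \<open>\<C>\<^sub>k\<close> have a
  Fourier transform that vanishes on an interval at least as long as \<open>|\<C>\<^sub>k|\<close>, which a
  Vandermonde system forbids; equality in the second would force \<open>N\<close> to divide the square of a small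
  nonzero difference of elements of \<open>\<C>\<^sub>k\<close>. Hence \<open>R\<^sub>k \<le> B \<rho>\<^sup>k\<close> with \<open>\<rho> < min M |A|\<^sup>2\<close>
  (\<open>fractal_uncertainty_principle\<close>), and \<open>\<rho> = M\<^bsup>1 - 2\<beta>0\<^esup>\<close> defines an exponent \<open>\<beta>0 > max 0 (1/2 - \<delta>)\<close>.
  
  \<^bold>\<open>Localization.\<close> The baker's map has the form \<open>F\<^sup>* D\<close> with \<open>D\<close> a symmetric contraction. Its entry
  \<open>(i, j)\<close> is negligible unless the leading digit of \<open>j\<close> lies in \<open>A\<close> and \<open>i / M\<close> is within \<open>M\<^sup>K\<close> of
  \<open>j mod N/M\<close> (\<open>baker_kernel_far\<close>, by repeated summation by parts). Following such pairs for
  \<open>t = k - K\<close> steps confines \<open>j\<close> to the \<open>4 M\<^sup>K\<close>-neighbourhood \<open>X\<close> of \<open>\<C>\<^sub>k\<close>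
  (\<open>trapped_near_full_cantor\<close>). Therefore an eigenvector \<open>u\<close> for \<open>\<mu>\<close> satisfies
  \<open>|\<mu>|\<^sup>t \<parallel>u\<parallel> \<le> \<parallel>1\<^sub>X u\<parallel> + small\<close>. Since \<open>D\<close> and \<open>F\<close> are symmetric, \<open>w = F u\<close> is an eigenvector of the
  \<^emph>\<open>transposed\<close> matrix for the same \<open>\<mu>\<close>, which makes \<open>w\<close> itself negligible outside \<open>X\<close>. Combining,
  \<open>|\<mu>|\<^sup>t \<le> \<parallel>1\<^sub>X F\<^sup>* 1\<^sub>X\<parallel> + small \<le> (8 M\<^sup>K + 1) sqrt (R\<^sub>k / N) + small\<close> (\<open>eigenvalue_inequality\<close>).
  With \<open>K\<close> about \<open>k / q\<close> and \<open>q\<close> large, the loss \<open>M\<^sup>K\<close> is absorbed by passing from \<open>\<beta>0\<close> to any smaller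
  \<open>\<beta>\<close>. Both \<open>\<rho>\<close> and \<open>\<beta>\<close> come from the uncertainty principle alone, hence serve all cutoffs at once;
  the cutoff only determines how large \<open>k\<close> must be.
\<close>

section \<open>Characters and the discrete Fourier transform\<close>

definition expi :: "real \<Rightarrow> complex" where
  "expi x = cis (2 * pi * x)"

lemma expi_add: "expi (x + y) = expi x * expi y"
  by (simp add: expi_def cis_mult algebra_simps)

lemma cmod_expi [simp]: "cmod (expi x) = 1"
  by (simp add: expi_def)

lemma expi_nonzero [simp]: "expi x \<noteq> 0"
  using cmod_expi[of x] by fastforce

lemma expi_0 [simp]: "expi 0 = 1"
  by (simp add: expi_def)

lemma expi_nat [simp]: "expi (real n) = 1"
  unfolding expi_def by (rule cis_multiple_2pi) auto

lemma cnj_expi: "cnj (expi x) = expi (- x)"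
  by (simp add: expi_def cis_cnj)

lemma expi_power: "expi x ^ n = expi (real n * x)"
  by (simp add: expi_def Complex.DeMoivre mult.left_commute)

lemma expi_eq_1_imp_int: "expi x = 1 \<Longrightarrow> x \<in> \<int>"
proof -
  assume "expi x = 1"
  hence "cos (2 * pi * x) = 1"
    by (metis cis.simps(1) expi_def one_complex.simps(1))
  then obtain n :: int where "2 * pi * x = of_int n * 2 * pi"
    unfolding cos_one_2pi_int by blast
  hence "x = of_int n" by (simp add: field_simps)
  thus ?thesis by simp
qed

lemma cmod_1_minus_expi: "cmod (1 - expi y) = 2 * \<bar>sin (pi * y)\<bar>"
proof -
  have "(cmod (1 - expi y))\<^sup>2 = (1 - cos (2 * pi * y))\<^sup>2 + (sin (2 * pi * y))\<^sup>2"
    by (simp add: cmod_power2 expi_def)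
  also have "\<dots> = 2 * (1 - cos (2 * pi * y))"
    using sin_cos_squared_add[of "2 * pi * y"] by (simp add: power2_eq_square algebra_simps)
  also have "cos (2 * pi * y) = 1 - 2 * (sin (pi * y))\<^sup>2"
    using cos_double_sin[of "pi * y"] by (simp add: mult_ac)
  finally have "(cmod (1 - expi y))\<^sup>2 = (2 * \<bar>sin (pi * y)\<bar>)\<^sup>2"
    by (simp add: power_mult_distrib)
  thus ?thesis by (rule power2_eq_imp_eq) simp_all
qed

lemma half_le_sin:
  assumes "0 \<le> x" "x \<le> pi / 2" shows "x / 2 \<le> sin x"
proof (cases "x \<le> pi / 3")
  case True
  show ?thesis
  proof (cases "x = 0")
    case False
    hence "0 < x" using assms by simp
    have "\<exists>z>0. z < x \<and> sin x - sin 0 = (x - 0) * cos z"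
      by (rule MVT2) (use \<open>0 < x\<close> in \<open>auto intro: DERIV_sin\<close>)
    then obtain z where z: "0 < z" "z < x" "sin x = x * cos z" by auto
    have "cos (pi / 3) \<le> cos z"
      by (rule cos_monotone_0_pi_le) (use z True in auto)
    hence "1 / 2 \<le> cos z" by (simp add: cos_60)
    thus ?thesis using z(3) mult_left_mono[of "1/2" "cos z" x] assms by simp
  qed simp
next
  case False
  have "sin (pi / 3) \<le> sin x"
    by (rule sin_monotone_2pi_le) (use assms False in auto)
  moreover have "1.7 \<le> sqrt (3::real)" by (rule real_le_rsqrt) (simp add: power2_eq_square)
  ultimately show ?thesis using assms pi_approx by (simp add: sin_60)
qed

text \<open>
  The gain in a summation by parts with phase \<open>y\<close>: the chord from 1 to \<open>exp (2\<pi>iy)\<close> is comparable to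
  the distance from \<open>y\<close> to the integers. The upper bound on \<open>|y|\<close> keeps \<open>y\<close> away from \<open>1\<close> and \<open>-1\<close>.
\<close>

lemma cmod_1_minus_expi_ge:
  assumes "0 < c" "t \<le> \<bar>y\<bar>" "\<bar>y\<bar> \<le> 1 - c" "0 \<le> t" "t \<le> 1"
  shows "c * t \<le> cmod (1 - expi y)"
proof -
  have c1: "c \<le> 1" using assms by linarith
  have s: "\<bar>sin (pi * y)\<bar> = sin (pi * \<bar>y\<bar>)"
  proof -
    have "0 \<le> sin (pi * \<bar>y\<bar>)" by (rule sin_ge_zero) (use assms in \<open>auto simp: mult_le_cancel_left1\<close>)
    thus ?thesis by (cases "y \<ge> 0") (auto simp: abs_if)
  qed
  have p: "2 \<le> pi" using pi_approx by simp
  show ?thesis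
  proof (cases "\<bar>y\<bar> \<le> 1/2")
    case True
    have "pi * \<bar>y\<bar> / 2 \<le> sin (pi * \<bar>y\<bar>)" by (rule half_le_sin) (use True in auto)
    moreover have "c * t \<le> pi * \<bar>y\<bar>"
      by (rule mult_mono) (use assms c1 p in auto)
    ultimately show ?thesis unfolding cmod_1_minus_expi s by simp
  next
    case False
    have "pi * (1 - \<bar>y\<bar>) / 2 \<le> sin (pi * (1 - \<bar>y\<bar>))"
      by (rule half_le_sin) (use False assms in auto)
    also have "\<dots> = sin (pi * \<bar>y\<bar>)"
      by (simp add: right_diff_distrib sin_diff)
    finally have "pi * (1 - \<bar>y\<bar>) \<le> 2 * sin (pi * \<bar>y\<bar>)" by simp
    moreover have "c * t \<le> (1 - \<bar>y\<bar>) * pi"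
      by (rule mult_mono) (use assms c1 p in auto)
    ultimately show ?thesis unfolding cmod_1_minus_expi s by (simp add: mult.commute)
  qed
qed

lemma sum_expi_orthogonal:
  fixes l l' N :: nat
  assumes "l < N" "l' < N"
  shows "(\<Sum>j<N. expi (real j * (real l - real l') / real N)) = (if l = l' then of_nat N else 0)"
proof (cases "l = l'")
  case False
  define w where "w = expi ((real l - real l') / real N)"
  have N: "0 < N" using assms by simp
  have wN: "w ^ N = 1"
  proof -
    have "w ^ N = expi (real l - real l')" using N by (simp add: w_def expi_power)
    also have "\<dots> = expi (real l) * cnj (expi (real l'))"
      using expi_add[of "real l" "- real l'"] by (simp only: cnj_expi diff_conv_add_uminus)
    finally show ?thesis by simp
  qed
  have w1: "w \<noteq> 1"
  proof
    assume "w = 1"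
    then obtain n where n: "(real l - real l') / real N = of_int n"
      using expi_eq_1_imp_int w_def Ints_cases by metis
    hence "real l - real l' = of_int (n * int N)" using N by (simp add: field_simps)
    hence "int l - int l' = n * int N" by linarith
    hence "int N dvd int l - int l'" by simp
    hence "int l - int l' = 0" using assms zdvd_imp_le[of "int N" "\<bar>int l - int l'\<bar>"] by fastforce
    thus False using False by simp
  qed
  have "(\<Sum>j<N. expi (real j * (real l - real l') / real N)) = (\<Sum>j<N. w ^ j)"
    by (simp add: w_def expi_power)
  also have "\<dots> = 0" using w1 wN by (simp add: sum_gp_strict)
  finally show ?thesis using False by simp
qed simp

lemma parseval:
  fixes g :: "nat \<Rightarrow> complex"
  assumes "0 < N"
  shows "(\<Sum>j<N. (cmod (\<Sum>l<N. expi (real j * real l / real N) * g l))\<^sup>2)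
    = real N * (\<Sum>l<N. (cmod (g l))\<^sup>2)"
proof -
  have phase: "expi (x * (a - b) / real N) = expi (x * a / real N) * expi (- (x * b / real N))" for x a b
    by (simp add: expi_add[symmetric] diff_divide_distrib right_diff_distrib)
  have "complex_of_real (\<Sum>j<N. (cmod (\<Sum>l<N. expi (real j * real l / real N) * g l))\<^sup>2)
    = (\<Sum>j<N. (\<Sum>l<N. expi (real j * real l / real N) * g l)
         * cnj (\<Sum>l<N. expi (real j * real l / real N) * g l))"
    by (simp only: of_real_sum complex_norm_square)
  also have "\<dots> = (\<Sum>j<N. \<Sum>l<N. \<Sum>l'<N.
      expi (real j * (real l - real l') / real N) * (g l * cnj (g l')))"
    unfolding phase by (simp add: sum_product cnj_expi mult_ac)
  also have "\<dots> = (\<Sum>l<N. \<Sum>l'<N. \<Sum>j<N.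
      expi (real j * (real l - real l') / real N) * (g l * cnj (g l')))"
    by (subst sum.swap, rule sum.cong[OF refl], rule sum.swap)
  also have "\<dots> = (\<Sum>l<N. \<Sum>l'<N. (if l = l' then of_nat N else 0) * (g l * cnj (g l')))"
    by (intro sum.cong refl) (simp add: sum_distrib_right[symmetric] sum_expi_orthogonal)
  also have "\<dots> = (\<Sum>l<N. of_nat N * (g l * cnj (g l)))"
    by (intro sum.cong refl) (simp add: if_distrib[of "\<lambda>x. x * _"] cong: if_cong)
  also have "\<dots> = complex_of_real (real N * (\<Sum>l<N. (cmod (g l))\<^sup>2))"
    by (simp add: complex_norm_square[symmetric] sum_distrib_left)
  finally show ?thesis unfolding of_real_eq_iff .
qed

section \<open>Uncertainty bounds and discrete Cantor sets\<close>

text \<open>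
  \<open>R\<close> bounds the squared operator norm of the Fourier kernel between functions on \<open>C\<close>. Leaving out the
  normalization by \<open>\<surd>N\<close> makes the trivial bounds \<open>N\<close> and \<open>|C|\<^sup>2\<close>, and makes bounds multiply exactly.
\<close>

definition uncertainty_bound :: "nat \<Rightarrow> nat set \<Rightarrow> real \<Rightarrow> bool" where
  "uncertainty_bound N C R \<longleftrightarrow> (\<forall>g.
     (\<Sum>j\<in>C. (cmod (\<Sum>l\<in>C. expi (real j * real l / real N) * g l))\<^sup>2)
       \<le> R * (\<Sum>l\<in>C. (cmod (g l))\<^sup>2))"

text \<open>
  With \<open>j = N\<^sub>1 a + b\<close> and \<open>l = N\<^sub>2 c + d\<close>, the phase \<open>j l / (N\<^sub>1 N\<^sub>2)\<close> equals
  \<open>a d / N\<^sub>2 + b d / (N\<^sub>1 N\<^sub>2) + b c / N\<^sub>1\<close> modulo integers. So the transform is a transform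
  \<open>c \<mapsto> b\<close> at scale \<open>N\<^sub>1\<close> for each \<open>d\<close>, a unimodular factor, and a transform \<open>d \<mapsto> a\<close> at scale \<open>N\<^sub>2\<close> for
  each \<open>b\<close>. The set must admit both digit orders, since the two variables are split differently.
\<close>

lemma uncertainty_bound_mult:
  assumes R2: "0 \<le> R2" and N: "0 < N1" "0 < N2"
    and b1: "uncertainty_bound N1 C1 R1" and b2: "uncertainty_bound N2 C2 R2"
    and D1: "bij_betw (\<lambda>(a, b). N1 * a + b) (C2 \<times> C1) D"
    and D2: "bij_betw (\<lambda>(c, d). N2 * c + d) (C1 \<times> C2) D"
  shows "uncertainty_bound (N1 * N2) D (R1 * R2)"
  unfolding uncertainty_bound_def
proof
  fix g :: "nat \<Rightarrow> complex"
  define H where "H b d = expi (real b * real d / real (N1 * N2)) *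
     (\<Sum>c\<in>C1. expi (real b * real c / real N1) * g (N2 * c + d))" for b d
  have phase: "expi (real (N1 * a + b) * real (N2 * c + d) / real (N1 * N2))
      = expi (real a * real d / real N2) * (expi (real b * real d / real (N1 * N2))
          * expi (real b * real c / real N1))" for a b c d
  proof -
    have eq: "real (N1 * a + b) * real (N2 * c + d) / real (N1 * N2)
      = real (a * c) + (real a * real d / real N2 + (real b * real d / real (N1 * N2)
          + real b * real c / real N1))"
      using N by (simp add: field_simps)
    show ?thesis unfolding eq expi_add expi_nat by simp
  qed
  have inner: "(\<Sum>l\<in>D. expi (real (N1 * a + b) * real l / real (N1 * N2)) * g l)
      = (\<Sum>d\<in>C2. expi (real a * real d / real N2) * H b d)" for a b
  proof -
    have "(\<Sum>l\<in>D. expi (real (N1 * a + b) * real l / real (N1 * N2)) * g l)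
      = (\<Sum>(c, d)\<in>C1 \<times> C2. expi (real (N1 * a + b) * real (N2 * c + d) / real (N1 * N2))
           * g (N2 * c + d))"
      by (subst sum.reindex_bij_betw[OF D2, symmetric]) (simp add: case_prod_unfold)
    also have "\<dots> = (\<Sum>d\<in>C2. \<Sum>c\<in>C1. expi (real (N1 * a + b) * real (N2 * c + d) / real (N1 * N2))
           * g (N2 * c + d))"
      by (subst sum.swap) (simp add: sum.cartesian_product)
    also have "\<dots> = (\<Sum>d\<in>C2. expi (real a * real d / real N2) * H b d)"
      unfolding H_def phase by (simp add: sum_distrib_left mult_ac)
    finally show ?thesis .
  qed
  have "(\<Sum>j\<in>D. (cmod (\<Sum>l\<in>D. expi (real j * real l / real (N1 * N2)) * g l))\<^sup>2)
      = (\<Sum>(a, b)\<in>C2 \<times> C1. (cmod (\<Sum>d\<in>C2. expi (real a * real d / real N2) * H b d))\<^sup>2)"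
    by (rule trans[OF sum.reindex_bij_betw[OF D1, symmetric]]) (simp only: case_prod_unfold inner)
  also have "\<dots> = (\<Sum>b\<in>C1. \<Sum>a\<in>C2. (cmod (\<Sum>d\<in>C2. expi (real a * real d / real N2) * H b d))\<^sup>2)"
    by (subst sum.swap) (simp add: sum.cartesian_product)
  also have "\<dots> \<le> (\<Sum>b\<in>C1. R2 * (\<Sum>d\<in>C2. (cmod (H b d))\<^sup>2))"
    by (rule sum_mono) (use b2 in \<open>simp add: uncertainty_bound_def\<close>)
  also have "\<dots> = R2 * (\<Sum>d\<in>C2. \<Sum>b\<in>C1. (cmod (H b d))\<^sup>2)"
    by (subst sum.swap) (simp add: sum_distrib_left)
  also have "\<dots> \<le> R2 * (\<Sum>d\<in>C2. R1 * (\<Sum>c\<in>C1. (cmod (g (N2 * c + d)))\<^sup>2))"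
  proof (intro mult_left_mono sum_mono R2)
    fix d
    show "(\<Sum>b\<in>C1. (cmod (H b d))\<^sup>2) \<le> R1 * (\<Sum>c\<in>C1. (cmod (g (N2 * c + d)))\<^sup>2)"
      using b1[unfolded uncertainty_bound_def, rule_format, of "\<lambda>c. g (N2 * c + d)"]
      by (simp add: H_def norm_mult)
  qed
  also have "\<dots> = R1 * R2 * (\<Sum>(c, d)\<in>C1 \<times> C2. (cmod (g (N2 * c + d)))\<^sup>2)"
    by (subst sum.cartesian_product[symmetric], subst sum.swap) (simp add: sum_distrib_left mult_ac)
  also have "(\<Sum>(c, d)\<in>C1 \<times> C2. (cmod (g (N2 * c + d)))\<^sup>2) = (\<Sum>l\<in>D. (cmod (g l))\<^sup>2)"
    by (subst sum.reindex_bij_betw[OF D2, symmetric]) (simp add: case_prod_unfold)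
  finally show "(\<Sum>j\<in>D. (cmod (\<Sum>l\<in>D. expi (real j * real l / real (N1 * N2)) * g l))\<^sup>2)
      \<le> R1 * R2 * (\<Sum>l\<in>D. (cmod (g l))\<^sup>2)" .
qed

text \<open>
  The recursion prepends a leading digit, which is how the leading digit of a point enters under the
  baker's map.
\<close>

primrec cantor :: "nat \<Rightarrow> nat set \<Rightarrow> nat \<Rightarrow> nat set" where
  "cantor M A 0 = {0}"
| "cantor M A (Suc k) = (\<lambda>(a, c). M ^ k * a + c) ` (A \<times> cantor M A k)"

lemma cantor_less:
  assumes "A \<subseteq> {0..<M}" "j \<in> cantor M A k"
  shows "j < M ^ k"
  using assms(2)
proof (induction k arbitrary: j)
  case (Suc k)
  then obtain a c where *: "a \<in> A" "c \<in> cantor M A k" "j = M ^ k * a + c" by auto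
  have "j < M ^ k * (a + 1)" using Suc.IH[OF *(2)] *(3) by simp
  also have "\<dots> \<le> M ^ k * M" by (rule mult_left_mono) (use * assms(1) in auto)
  finally show ?case by (simp add: mult.commute)
qed simp

lemma finite_cantor: "A \<subseteq> {0..<M} \<Longrightarrow> finite (cantor M A k)"
  by (rule finite_subset[of _ "{..<M ^ k}"]) (auto dest: cantor_less)

lemma inj_on_digits:
  fixes m :: nat
  assumes "\<And>b. b \<in> B \<Longrightarrow> b < m"
  shows "inj_on (\<lambda>(a, b). m * a + b) (S \<times> B)"
proof (rule inj_onI, clarsimp)
  fix a b a' b' assume *: "b \<in> B" "b' \<in> B" "m * a + b = m * a' + b'"
  have "(m * a + b) div m = (m * a' + b') div m" "(m * a + b) mod m = (m * a' + b') mod m"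
    using * by auto
  thus "a = a' \<and> b = b'" using assms[OF *(1)] assms[OF *(2)] by simp
qed

lemma cantor_split:
  assumes "A \<subseteq> {0..<M}"
  shows "bij_betw (\<lambda>(a, b). M ^ k1 * a + b) (cantor M A k2 \<times> cantor M A k1) (cantor M A (k1 + k2))"
proof (rule bij_betw_imageI)
  show "inj_on (\<lambda>(a, b). M ^ k1 * a + b) (cantor M A k2 \<times> cantor M A k1)"
    by (rule inj_on_digits) (rule cantor_less[OF assms])
  show "(\<lambda>(a, b). M ^ k1 * a + b) ` (cantor M A k2 \<times> cantor M A k1) = cantor M A (k1 + k2)"
  proof (induction k2)
    case (Suc k2)
    have "cantor M A (k1 + Suc k2)
      = (\<lambda>(a, c). M ^ (k1 + k2) * a + c) ` (A \<times> (\<lambda>(a, b). M ^ k1 * a + b) ` (cantor M A k2 \<times> cantor M A k1))"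
      by (simp add: Suc.IH)
    also have "\<dots> = (\<Union>a\<in>A. \<Union>a'\<in>cantor M A k2. \<Union>b\<in>cantor M A k1. {M ^ k1 * (M ^ k2 * a + a') + b})"
      by (force simp: power_add algebra_simps)
    also have "\<dots> = (\<lambda>(a, b). M ^ k1 * a + b) ` (cantor M A (Suc k2) \<times> cantor M A k1)"
      by force
    finally show ?case by simp
  qed (auto simp: image_iff)
qed

lemma card_cantor:
  assumes "A \<subseteq> {0..<M}" shows "card (cantor M A k) = card A ^ k"
proof (induction k)
  case (Suc k)
  have "inj_on (\<lambda>(a, c). M ^ k * a + c) (A \<times> cantor M A k)"
    by (rule inj_on_digits) (rule cantor_less[OF assms])
  thus ?case using Suc by (simp add: card_image card_cartesian_product)
qed simp

lemma uncertainty_bound_add: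
  assumes "A \<subseteq> {0..<M}" "0 < M" "0 \<le> R2"
    and "uncertainty_bound (M ^ k1) (cantor M A k1) R1"
    and "uncertainty_bound (M ^ k2) (cantor M A k2) R2"
  shows "uncertainty_bound (M ^ (k1 + k2)) (cantor M A (k1 + k2)) (R1 * R2)"
  unfolding power_add
  by (rule uncertainty_bound_mult)
     (use assms cantor_split[OF assms(1), of k1 k2] cantor_split[OF assms(1), of k2 k1]
       in \<open>simp_all add: add.commute\<close>)

lemma uncertainty_bound_trivial:
  assumes "C \<subseteq> {..<N}" "0 < N"
  shows "uncertainty_bound N C (real N)"
  unfolding uncertainty_bound_def
proof
  fix g :: "nat \<Rightarrow> complex"
  define h where "h l = (if l \<in> C then g l else 0)" for l
  have *: "(\<Sum>l\<in>C. expi (real j * real l / real N) * g l) = (\<Sum>l<N. expi (real j * real l / real N) * h l)" for j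
    by (rule sum.mono_neutral_cong_left) (use assms in \<open>auto simp: h_def\<close>)
  have "(\<Sum>j\<in>C. (cmod (\<Sum>l\<in>C. expi (real j * real l / real N) * g l))\<^sup>2)
      \<le> (\<Sum>j<N. (cmod (\<Sum>l<N. expi (real j * real l / real N) * h l))\<^sup>2)"
    unfolding * by (rule sum_mono2) (use assms in auto)
  also have "\<dots> = real N * (\<Sum>l<N. (cmod (h l))\<^sup>2)" by (rule parseval[OF assms(2)])
  also have "(\<Sum>l<N. (cmod (h l))\<^sup>2) = (\<Sum>l\<in>C. (cmod (g l))\<^sup>2)"
    by (rule sum.mono_neutral_cong_right) (use assms in \<open>auto simp: h_def\<close>)
  finally show "(\<Sum>j\<in>C. (cmod (\<Sum>l\<in>C. expi (real j * real l / real N) * g l))\<^sup>2)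
      \<le> real N * (\<Sum>l\<in>C. (cmod (g l))\<^sup>2)" .
qed

section \<open>The fractal uncertainty principle\<close>

text \<open>
  Testing the vanishing moments against the polynomial with roots at all nodes but \<open>z l0\<close>, whose
  degree is \<open>card C - 1\<close>, isolates the weight at \<open>l0\<close>.
\<close>

lemma vandermonde_zero:
  fixes z h :: "'b \<Rightarrow> complex"
  assumes fin: "finite C" and inj: "inj_on z C"
    and zero: "\<And>t. t < card C \<Longrightarrow> (\<Sum>l\<in>C. h l * z l ^ t) = 0"
    and l0: "l0 \<in> C"
  shows "h l0 = 0"
proof -
  define p where "p = (\<Prod>l\<in>C - {l0}. [:- z l, 1:])"
  have "degree p = card (C - {l0})"
    unfolding p_def by (subst degree_prod_eq_sum_degree) auto
  hence deg: "degree p < card C"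
    using fin l0 by (metis card_Diff1_less)
  have p_eq: "poly p x = (\<Prod>l\<in>C - {l0}. x - z l)" for x
    by (simp add: p_def poly_prod)
  have "(\<Sum>l\<in>C. h l * poly p (z l)) = (\<Sum>t\<le>degree p. coeff p t * (\<Sum>l\<in>C. h l * z l ^ t))"
    unfolding poly_altdef sum_distrib_left by (subst sum.swap) (simp add: mult_ac)
  also have "\<dots> = 0" using zero deg by simp
  also have "(\<Sum>l\<in>C. h l * poly p (z l)) = (\<Sum>l\<in>{l0}. h l * poly p (z l))"
    by (rule sum.mono_neutral_right) (use fin l0 in \<open>auto simp: p_eq\<close>)
  finally have "h l0 * poly p (z l0) = 0" by simp
  moreover have "poly p (z l0) \<noteq> 0"
    using fin inj l0 by (auto simp: p_eq inj_on_def)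
  ultimately show ?thesis by simp
qed

lemma inj_on_expi_div: "inj_on (\<lambda>l. expi (real l / real N)) {..<N}"
proof (rule inj_onI)
  fix l l' assume l: "l \<in> {..<N}" "l' \<in> {..<N}" and eq: "expi (real l / real N) = expi (real l' / real N)"
  have "expi ((real l - real l') / real N) = expi (real l / real N) * cnj (expi (real l' / real N))"
    by (simp add: cnj_expi expi_add[symmetric] diff_divide_distrib)
  also have "\<dots> = 1" unfolding eq by (simp add: complex_norm_square[symmetric])
  finally obtain n where n: "(real l - real l') / real N = of_int n"
    using expi_eq_1_imp_int Ints_cases by metis
  have "real l - real l' = of_int (n * int N)" using n l by (simp add: field_simps)
  hence "int l - int l' = n * int N" by linarith
  hence "int N dvd int l - int l'" by simp
  hence "int l - int l' = 0" using l zdvd_imp_le[of "int N" "\<bar>int l - int l'\<bar>"] by fastforce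
  thus "l = l'" by simp
qed

text \<open>
  By Parseval, equality in the trivial bound \<open>N\<close> would confine the Fourier transform of \<open>g\<close> to \<open>C\<close>. It
  then vanishes at \<open>card C\<close> consecutive points, which are consecutive power moments of the weights
  \<open>g\<close> (up to unimodular factors) on \<open>card C\<close> distinct roots of unity.
\<close>

lemma energy_less_of_gap:
  assumes C: "C \<subseteq> {..<N}" and gap: "{J..<J + card C} \<subseteq> {..<N} - C"
    and nz: "l0 \<in> C" "g l0 \<noteq> 0"
  shows "(\<Sum>j\<in>C. (cmod (\<Sum>l\<in>C. expi (real j * real l / real N) * g l))\<^sup>2)
      < real N * (\<Sum>l\<in>C. (cmod (g l))\<^sup>2)"
proof (rule ccontr)
  assume neg: "\<not> ?thesis"
  have fin: "finite C" using C finite_subset by blast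
  have N: "0 < N" using C nz by fastforce
  define h where "h l = (if l \<in> C then g l else 0)" for l
  define G where "G j = (\<Sum>l\<in>C. expi (real j * real l / real N) * g l)" for j
  have G: "G j = (\<Sum>l<N. expi (real j * real l / real N) * h l)" for j
    unfolding G_def by (rule sum.mono_neutral_cong_left) (use C in \<open>auto simp: h_def\<close>)
  have tot: "(\<Sum>j<N. (cmod (G j))\<^sup>2) = real N * (\<Sum>l\<in>C. (cmod (g l))\<^sup>2)"
  proof -
    have "(\<Sum>l<N. (cmod (h l))\<^sup>2) = (\<Sum>l\<in>C. (cmod (g l))\<^sup>2)"
      by (rule sum.mono_neutral_cong_right) (use C in \<open>auto simp: h_def\<close>)
    thus ?thesis unfolding G parseval[OF N] by simp
  qed
  have "(\<Sum>j<N. (cmod (G j))\<^sup>2) = (\<Sum>j\<in>{..<N} - C. (cmod (G j))\<^sup>2) + (\<Sum>j\<in>C. (cmod (G j))\<^sup>2)"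
    by (rule sum.subset_diff) (use C in auto)
  hence "(\<Sum>j\<in>{..<N} - C. (cmod (G j))\<^sup>2) \<le> 0"
    using neg tot unfolding G_def[symmetric] by linarith
  hence "(\<Sum>j\<in>{..<N} - C. (cmod (G j))\<^sup>2) = 0"
    by (intro antisym sum_nonneg) auto
  hence "\<forall>j\<in>{..<N} - C. (cmod (G j))\<^sup>2 = 0"
    by (subst (asm) sum_nonneg_eq_0_iff) auto
  hence z: "G j = 0" if "j \<in> {J..<J + card C}" for j
    using that gap by auto
  have "expi (real J * real l0 / real N) * g l0 = 0"
  proof (rule vandermonde_zero[OF fin])
    show "inj_on (\<lambda>l. expi (real l / real N)) C"
      using inj_on_expi_div C by (rule inj_on_subset)
    fix t assume "t < card C"
    hence "G (J + t) = 0" by (intro z) auto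
    moreover have "expi (real (J + t) * real l / real N)
        = expi (real J * real l / real N) * expi (real l / real N) ^ t" for l
      by (simp add: expi_power expi_add[symmetric] add_divide_distrib distrib_right)
    ultimately    show "(\<Sum>l\<in>C. (expi (real J * real l / real N) * g l) * expi (real l / real N) ^ t) = 0"
      by (simp add: G_def mult_ac)
  qed (rule nz)
  thus False using nz by simp
qed

text \<open>
  Lagrange's identity, which exhibits the defect in Cauchy-Schwarz as a sum of squares.
\<close>

lemma sum_cmod_diff_squares:
  fixes h :: "'b \<Rightarrow> complex"
  shows "(\<Sum>l\<in>C. \<Sum>m\<in>C. (cmod (h l - h m))\<^sup>2)
    = 2 * (real (card C) * (\<Sum>l\<in>C. (cmod (h l))\<^sup>2) - (cmod (\<Sum>l\<in>C. h l))\<^sup>2)"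
proof -
  have "(cmod (a - b))\<^sup>2 = (cmod a)\<^sup>2 + (cmod b)\<^sup>2 - 2 * Re (a * cnj b)" for a b
    unfolding cmod_power2 by (simp add: power2_eq_square algebra_simps)
  hence "(\<Sum>l\<in>C. \<Sum>m\<in>C. (cmod (h l - h m))\<^sup>2)
    = 2 * (real (card C) * (\<Sum>l\<in>C. (cmod (h l))\<^sup>2)) - 2 * (\<Sum>l\<in>C. \<Sum>m\<in>C. Re (h l * cnj (h m)))"
    by (simp add: sum.distrib sum_subtractf sum_distrib_left)
  also have "(\<Sum>l\<in>C. \<Sum>m\<in>C. Re (h l * cnj (h m))) = Re ((\<Sum>l\<in>C. h l) * cnj (\<Sum>l\<in>C. h l))"
    by (simp only: sum_product Re_sum cnj_sum)
  also have "\<dots> = (cmod (\<Sum>l\<in>C. h l))\<^sup>2"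
    unfolding complex_norm_square[symmetric] by simp
  finally show ?thesis by (simp add: algebra_simps)
qed

lemma cmod_sum_squared_le:
  fixes h :: "'b \<Rightarrow> complex"
  shows "(cmod (\<Sum>l\<in>C. h l))\<^sup>2 \<le> real (card C) * (\<Sum>l\<in>C. (cmod (h l))\<^sup>2)"
proof -
  have "0 \<le> (\<Sum>l\<in>C. \<Sum>m\<in>C. (cmod (h l - h m))\<^sup>2)" by (intro sum_nonneg) auto
  thus ?thesis unfolding sum_cmod_diff_squares by simp
qed

lemma cmod_sum_squared_less:
  fixes h :: "'b \<Rightarrow> complex"
  assumes "finite C" "l \<in> C" "m \<in> C" "h l \<noteq> h m"
  shows "(cmod (\<Sum>l\<in>C. h l))\<^sup>2 < real (card C) * (\<Sum>l\<in>C. (cmod (h l))\<^sup>2)"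
proof -
  have "0 < (\<Sum>m\<in>C. (cmod (h l - h m))\<^sup>2)"
    by (rule sum_pos2[of _ m]) (use assms in auto)
  hence "0 < (\<Sum>l\<in>C. \<Sum>m\<in>C. (cmod (h l - h m))\<^sup>2)"
    by (rule sum_pos2[OF assms(1,2)]) (auto intro: sum_nonneg)
  thus ?thesis unfolding sum_cmod_diff_squares by simp
qed

text \<open>
  Equality in the bound \<open>(card C)\<^sup>2\<close> forces equality in Cauchy-Schwarz for every \<open>j\<close>, i.e. the terms
  \<open>exp (2\<pi>ijl/N) g l\<close> do not depend on \<open>l\<close>. Comparing \<open>j1\<close> and \<open>j2\<close> at \<open>l = j1\<close> and \<open>l = j2\<close>
  eliminates \<open>g\<close> and makes \<open>(j2 - j1)\<^sup>2 / N\<close> an integer.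
\<close>

lemma energy_less_of_nonresonant:
  assumes C: "C \<subseteq> {..<N}" and jj: "j1 \<in> C" "j2 \<in> C" "j1 < j2" "(j2 - j1)\<^sup>2 < N"
    and nz: "l0 \<in> C" "g l0 \<noteq> 0"
  shows "(\<Sum>j\<in>C. (cmod (\<Sum>l\<in>C. expi (real j * real l / real N) * g l))\<^sup>2)
      < (real (card C))\<^sup>2 * (\<Sum>l\<in>C. (cmod (g l))\<^sup>2)"
proof -
  have fin: "finite C" using C finite_subset by blast
  define E where "E j l = expi (real j * real l / real N)" for j l :: nat
  have le: "(cmod (\<Sum>l\<in>C. E j l * g l))\<^sup>2 \<le> real (card C) * (\<Sum>l\<in>C. (cmod (g l))\<^sup>2)" for j
    using cmod_sum_squared_le[of "\<lambda>l. E j l * g l" C] by (simp add: norm_mult E_def)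
  have lt: "(cmod (\<Sum>l\<in>C. E j l * g l))\<^sup>2 < real (card C) * (\<Sum>l\<in>C. (cmod (g l))\<^sup>2)"
    if "l \<in> C" "m \<in> C" "E j l * g l \<noteq> E j m * g m" for j l m
    using cmod_sum_squared_less[OF fin that(1,2), of "\<lambda>l. E j l * g l"] that(3)
    by (simp add: norm_mult E_def)
  have "\<exists>j\<in>C. \<exists>l\<in>C. \<exists>m\<in>C. E j l * g l \<noteq> E j m * g m"
  proof (rule ccontr)
    assume "\<not> ?thesis"
    hence eq: "E j l * g l = E j m * g m" if "j \<in> C" "l \<in> C" "m \<in> C" for j l m
      using that by blast
    have g_nz: "g l \<noteq> 0" if "l \<in> C" for l
      using eq[OF jj(1) that nz(1)] nz(2) by (auto simp: E_def)
    have "E j1 j1 * g j1 * (E j2 j2 * g j2) = E j1 j2 * g j2 * (E j2 j1 * g j1)"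
      using eq[OF jj(1) jj(1) jj(2)] eq[OF jj(2) jj(2) jj(1)] by simp
    hence E: "E j1 j1 * E j2 j2 = E j1 j2 * E j2 j1"
      using g_nz[OF jj(1)] g_nz[OF jj(2)] by (simp add: mult_ac)
    have "expi ((real j2 - real j1)\<^sup>2 / real N) = E j1 j1 * E j2 j2 * cnj (E j1 j2 * E j2 j1)"
      by (simp add: E_def cnj_expi expi_add[symmetric] power2_eq_square algebra_simps
          diff_divide_distrib add_divide_distrib)
    also have "\<dots> = 1"
      unfolding E by (simp add: E_def cnj_expi expi_add[symmetric])
    finally have "expi ((real j2 - real j1)\<^sup>2 / real N) = 1" .
    then obtain n where n: "(real j2 - real j1)\<^sup>2 / real N = of_int n"
      using expi_eq_1_imp_int Ints_cases by metis
    have s: "(real j2 - real j1)\<^sup>2 = real ((j2 - j1)\<^sup>2)" using jj by (simp add: of_nat_diff)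
    have "0 < (real j2 - real j1)\<^sup>2 / real N" "(real j2 - real j1)\<^sup>2 / real N < 1"
      unfolding s using jj by (simp_all add: divide_less_eq of_nat_less_iff del: of_nat_power)
    thus False unfolding n by simp
  qed
  then obtain j l m where "j \<in> C" "l \<in> C" "m \<in> C" "E j l * g l \<noteq> E j m * g m" by blast
  hence "(\<Sum>j\<in>C. (cmod (\<Sum>l\<in>C. E j l * g l))\<^sup>2) < (\<Sum>j\<in>C. real (card C) * (\<Sum>l\<in>C. (cmod (g l))\<^sup>2))"
    by (intro sum_strict_mono_ex1 fin ballI le) (auto intro: lt)
  thus ?thesis by (simp add: E_def power2_eq_square mult_ac)
qed

text \<open>
  Strict inequality for each vector improves to a smaller constant because the unit sphere of a
  finite-dimensional space is compact.
\<close>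

lemma uncertainty_bound_of_strict:
  assumes fin: "finite C"
    and strict: "\<And>g l0. l0 \<in> C \<Longrightarrow> g l0 \<noteq> 0 \<Longrightarrow>
       (\<Sum>j\<in>C. (cmod (\<Sum>l\<in>C. expi (real j * real l / real N) * g l))\<^sup>2)
         < R * (\<Sum>l\<in>C. (cmod (g l))\<^sup>2)"
    and R: "0 < R"
  shows "\<exists>R'. 0 < R' \<and> R' < R \<and> uncertainty_bound N C R'"
proof (cases "C = {}")
  case True
  thus ?thesis using R by (intro exI[of _ "R/2"]) (simp add: uncertainty_bound_def)
next
  case False
  then obtain c where c: "c \<in> C" by auto
  define S where "S g = (\<Sum>j\<in>C. (cmod (\<Sum>l\<in>C. expi (real j * real l / real N) * g l))\<^sup>2)" for g
  define Q where "Q g = (\<Sum>l\<in>C. (cmod (g l))\<^sup>2)" for g :: "nat \<Rightarrow> complex"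
  \<comment> \<open>Vectors are functions on all of the naturals, so the coordinates outside \<open>C\<close> are pinned to zero;
    the unit sphere is then closed in a product of compact sets.\<close>
  define K where "K = (\<Pi>\<^sub>E i\<in>UNIV. if i \<in> C then cball (0::complex) 1 else {0})"
  have "compact K"
    unfolding K_def compactin_euclidean_iff[symmetric] euclidean_product_topology[symmetric]
    by (subst compactin_PiE) auto
  moreover have cS: "continuous_on UNIV S" and cQ: "continuous_on UNIV Q"
    unfolding S_def Q_def by (intro continuous_intros continuous_on_product_coordinates)+
  have "closed {g. Q g = 1}"
    by (rule closed_Collect_eq) (use cQ in auto)
  ultimately have comp: "compact (K \<inter> {g. Q g = 1})"
    by (rule compact_Int_closed)
  have "(\<lambda>i. if i = c then 1 else 0) \<in> K \<inter> {g. Q g = 1}"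
    using c fin by (auto simp: K_def Q_def PiE_def if_distrib[of cmod] if_distrib[of "\<lambda>x. x\<^sup>2"] cong: if_cong)
  hence "K \<inter> {g. Q g = 1} \<noteq> {}" by blast
  then obtain g0 where g0: "g0 \<in> K" "Q g0 = 1" and max: "\<And>g. g \<in> K \<Longrightarrow> Q g = 1 \<Longrightarrow> S g \<le> S g0"
    using continuous_attains_sup[OF comp _ continuous_on_subset[OF cS]] by auto
  have "\<exists>l\<in>C. g0 l \<noteq> 0"
  proof (rule ccontr)
    assume "\<not> ?thesis"
    hence "Q g0 = 0" by (simp add: Q_def)
    thus False using g0 by simp
  qed
  hence lt: "S g0 < R" using strict[of _ g0] g0 by (auto simp: S_def Q_def)
  have S0: "0 \<le> S g" for g unfolding S_def by (intro sum_nonneg) auto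
  have main: "S g \<le> S g0 * Q g" for g
  proof (cases "Q g = 0")
    case True
    hence "\<forall>l\<in>C. g l = 0" unfolding Q_def using fin by (subst (asm) sum_nonneg_eq_0_iff) auto
    hence "S g = 0" by (simp add: S_def)
    thus ?thesis using True by simp
  next
    case False
    have "0 \<le> Q g" unfolding Q_def by (intro sum_nonneg) auto
    hence Q: "0 < Q g" using False by simp
    define g' where "g' l = (if l \<in> C then g l / of_real (sqrt (Q g)) else 0)" for l
    have Q': "Q g' = 1"
      using Q by (simp add: Q_def g'_def norm_divide power_divide sum_divide_distrib[symmetric])
    have S': "S g' = S g / Q g"
    proof -
      have "(\<Sum>l\<in>C. expi (real j * real l / real N) * g' l)
        = (\<Sum>l\<in>C. expi (real j * real l / real N) * g l) / of_real (sqrt (Q g))" for j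
        by (simp add: g'_def sum_divide_distrib)
      thus ?thesis using Q by (simp add: S_def norm_divide power_divide sum_divide_distrib[symmetric])
    qed
    have "cmod (g' l) \<le> 1" if "l \<in> C" for l
    proof -
      have "(cmod (g' l))\<^sup>2 \<le> Q g'" unfolding Q_def
        by (rule member_le_sum) (use that fin in auto)
      thus ?thesis using Q' by (simp add: power_le_one_iff)
    qed
    hence "g' \<in> K" by (auto simp: K_def PiE_def g'_def)
    from max[OF this Q'] have "S g / Q g \<le> S g0" unfolding S' .
    thus ?thesis using Q by (simp add: divide_le_eq)
  qed
  define R' where "R' = (S g0 + R) / 2"
  have "uncertainty_bound N C R'"
    unfolding uncertainty_bound_def S_def[symmetric] Q_def[symmetric]
  proof
    fix g
    have "0 \<le> Q g" unfolding Q_def by (intro sum_nonneg) auto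
    hence "S g0 * Q g \<le> R' * Q g" by (intro mult_right_mono) (use lt in \<open>auto simp: R'_def\<close>)
    thus "S g \<le> R' * Q g" using main[of g] by linarith
  qed
  thus ?thesis using lt S0[of g0] R by (intro exI[of _ R']) (auto simp: R'_def)
qed

lemma uncertainty_bound_mono:
  assumes "uncertainty_bound N C R" "R \<le> R'"
  shows "uncertainty_bound N C R'"
  unfolding uncertainty_bound_def
proof
  fix g :: "nat \<Rightarrow> complex"
  have "R * (\<Sum>l\<in>C. (cmod (g l))\<^sup>2) \<le> R' * (\<Sum>l\<in>C. (cmod (g l))\<^sup>2)"
    by (intro mult_right_mono assms sum_nonneg) auto
  thus "(\<Sum>j\<in>C. (cmod (\<Sum>l\<in>C. expi (real j * real l / real N) * g l))\<^sup>2)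
      \<le> R' * (\<Sum>l\<in>C. (cmod (g l))\<^sup>2)"
    using assms(1) unfolding uncertainty_bound_def by (meson order_trans)
qed

text \<open>
  A missing digit \<open>b\<close>, used as the leading digit, leaves a gap that is a fixed fraction of the whole
  interval.
\<close>

lemma cantor_gap:
  assumes A: "A \<subseteq> {0..<M}" and b: "b < M" "b \<notin> A"
  shows "{M ^ k * b..<M ^ k * b + M ^ k} \<subseteq> {..<M ^ Suc k} - cantor M A (Suc k)"
proof
  fix j assume j: "j \<in> {M ^ k * b..<M ^ k * b + M ^ k}"
  have "j div M ^ k = b"
    using j by (intro div_nat_eqI) (auto simp: algebra_simps)
  moreover have "a = j div M ^ k" if "j = M ^ k * a + c" "c \<in> cantor M A k" for a c
    unfolding that(1) by (rule div_nat_eqI[symmetric]) (use cantor_less[OF A that(2)] in simp_all)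
  ultimately have "j \<notin> cantor M A (Suc k)" using b by auto
  moreover have "j < M ^ Suc k"
  proof -
    have "j < M ^ k * (b + 1)" using j by simp
    also have "\<dots> \<le> M ^ k * M" by (rule mult_left_mono) (use b in auto)
    finally show ?thesis by (simp add: mult.commute)
  qed
  ultimately show "j \<in> {..<M ^ Suc k} - cantor M A (Suc k)" by simp
qed

lemma cantor_nonempty: "A \<noteq> {} \<Longrightarrow> cantor M A k \<noteq> {}"
  by (induction k) auto

text \<open>
  Since \<open>card A < M\<close>, at a fine enough scale the gap of length \<open>M\<^sup>k\<close> exceeds the number of points
  \<open>(card A)\<^bsup>k+1\<^esup>\<close>. Points that differ in the last digit only have a difference below \<open>M\<close>, whose square is
  below \<open>M\<^bsup>k+1\<^esup>\<close>.
\<close>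

lemma ex_strict_scale:
  assumes A: "A \<subseteq> {0..<M}" and c1: "1 < card A" and cM: "card A < M"
  shows "\<exists>k R. 0 < k \<and> 0 < R \<and> R < real M ^ k \<and> R < (real (card A))\<^sup>2 ^ k
     \<and> uncertainty_bound (M ^ k) (cantor M A k) R"
proof -
  have finA: "finite A" using A finite_subset by blast
  obtain b where b: "b < M" "b \<notin> A"
  proof -
    have "card A < card {0..<M}" using cM by simp
    hence "\<not> {0..<M} \<subseteq> A" using card_mono[OF finA] by (metis not_le)
    hence "\<exists>b<M. b \<notin> A" by (auto simp: subset_iff)
    thus ?thesis using that by blast
  qed
  have "1 < real M / real (card A)" using c1 cM by simp
  then obtain k where "real (card A) < (real M / real (card A)) ^ k"
    using real_arch_pow by blast
  hence "real (card A) * real (card A) ^ k < real M ^ k"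
    using c1 by (simp add: power_divide pos_less_divide_eq)
  hence "real (card A ^ Suc k) < real (M ^ k)" by simp
  hence k: "card A ^ Suc k < M ^ k" unfolding of_nat_less_iff .
  have k1: "1 \<le> k" using k c1 by (cases k) auto
  define C where "C = cantor M A (Suc k)"
  have sub: "C \<subseteq> {..<M ^ Suc k}" unfolding C_def by (auto simp del: cantor.simps dest: cantor_less[OF A])
  have cardC: "card C = card A ^ Suc k" unfolding C_def by (rule card_cantor[OF A])
  have gap: "{M ^ k * b..<M ^ k * b + card C} \<subseteq> {..<M ^ Suc k} - C"
  proof -
    have "{M ^ k * b..<M ^ k * b + card C} \<subseteq> {M ^ k * b..<M ^ k * b + M ^ k}"
      using k by (simp add: cardC)
    also have "\<dots> \<subseteq> {..<M ^ Suc k} - C" unfolding C_def by (rule cantor_gap[OF A b])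
    finally show ?thesis .
  qed
  obtain a1 a2 where a: "a1 \<in> A" "a2 \<in> A" "a1 < a2"
  proof -
    from c1 obtain x y where "x \<in> A" "y \<in> A" "x \<noteq> y"
      by (metis One_nat_def card_le_Suc0_iff_eq finA not_le)
    thus ?thesis using that by (metis linorder_neqE_nat)
  qed
  obtain z where z: "z \<in> cantor M A k" using cantor_nonempty[of A] a by blast
  have mem: "M * z + x \<in> C" if "x \<in> A" for x
  proof -
    have "x \<in> cantor M A 1" using that by (simp add: image_iff)
    hence "(\<lambda>(a, b). M ^ 1 * a + b) (z, x) \<in> cantor M A (1 + k)"
      unfolding bij_betw_imp_surj_on[OF cantor_split[OF A, of 1 k], symmetric]
      using z by (intro imageI) simp
    thus ?thesis by (simp add: C_def)
  qed
  have "(a2 - a1)\<^sup>2 < M ^ Suc k"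
  proof -
    have "a2 - a1 < M" using a A by fastforce
    hence "(a2 - a1)\<^sup>2 < M\<^sup>2" by (intro power_strict_mono) auto
    also have "\<dots> \<le> M ^ Suc k" by (rule power_increasing) (use k1 b in auto)
    finally show ?thesis .
  qed
  hence nr: "(M * z + a2 - (M * z + a1))\<^sup>2 < M ^ Suc k" by simp
  define R where "R = min (real M ^ Suc k) ((real (card A))\<^sup>2 ^ Suc k)"
  have "0 < R" using c1 cM by (simp add: R_def)
  moreover have "(\<Sum>j\<in>C. (cmod (\<Sum>l\<in>C. expi (real j * real l / real (M ^ Suc k)) * g l))\<^sup>2)
         < R * (\<Sum>l\<in>C. (cmod (g l))\<^sup>2)" if "l0 \<in> C" "g l0 \<noteq> 0" for g l0
  proof -
    have sq: "(real (card C))\<^sup>2 = (real (card A))\<^sup>2 ^ Suc k"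
      by (simp add: cardC power_mult_distrib power_mult[symmetric] mult.commute power2_eq_square)
    have "M * z + a1 < M * z + a2" using a(3) by simp
    thus ?thesis
      using energy_less_of_gap[where g = g, OF sub gap that]
        energy_less_of_nonresonant[where g = g, OF sub mem[OF a(1)] mem[OF a(2)] _ nr that]
      unfolding R_def min_def sq of_nat_power by presburger
  qed
  ultimately obtain R' where "0 < R'" "R' < R" "uncertainty_bound (M ^ Suc k) C R'"
    using uncertainty_bound_of_strict[of C "M ^ Suc k" R] finite_subset[OF sub] by auto
  thus ?thesis unfolding R_def C_def by (intro exI[of _ "Suc k"] exI[of _ R']) auto
qed

text \<open>
  A bound that is strictly better than both trivial ones at a single scale becomes exponentially
  better by multiplicativity. Scales that are not multiples of the good one cost the constant \<open>B\<close>.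
\<close>

theorem fractal_uncertainty_principle:
  assumes A: "A \<subseteq> {0..<M}" and c1: "1 < card A" and cM: "card A < M"
  shows "\<exists>\<rho> B. 0 < \<rho> \<and> \<rho> < real M \<and> \<rho> < (real (card A))\<^sup>2 \<and> 0 < B
     \<and> (\<forall>k. uncertainty_bound (M ^ k) (cantor M A k) (B * \<rho> ^ k))"
proof -
  have M: "0 < M" using cM by simp
  obtain k0 R where k0: "0 < k0" and R: "0 < R" "R < real M ^ k0" "R < (real (card A))\<^sup>2 ^ k0"
    and ub: "uncertainty_bound (M ^ k0) (cantor M A k0) R"
    using ex_strict_scale[OF assms] by blast
  define \<rho> where "\<rho> = root k0 R"
  have \<rho>0: "0 < \<rho>" using R k0 by (simp add: \<rho>_def)
  have pow: "\<rho> ^ k0 = R" using R k0 by (simp add: \<rho>_def)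
  have \<rho>M: "\<rho> < real M" by (rule power_less_imp_less_base[of _ k0]) (use R pow in auto)
  have \<rho>A: "\<rho> < (real (card A))\<^sup>2" by (rule power_less_imp_less_base[of _ k0]) (use R pow in auto)
  have iter: "uncertainty_bound (M ^ (n * k0)) (cantor M A (n * k0)) (R ^ n)" for n
  proof (induction n)
    case 0
    show ?case by (simp add: uncertainty_bound_def)
  next
    case (Suc n)
    show ?case using uncertainty_bound_add[OF A M _ ub Suc] R by simp
  qed
  define B where "B = (real M / \<rho>) ^ k0"
  have "uncertainty_bound (M ^ k) (cantor M A k) (B * \<rho> ^ k)" for k
  proof -
    define n r where "n = k div k0" and "r = k mod k0"
    have k: "k = n * k0 + r" by (simp add: n_def r_def)
    have "cantor M A r \<subseteq> {..<M ^ r}" using cantor_less[OF A] by auto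
    from uncertainty_bound_trivial[OF this]
    have "uncertainty_bound (M ^ r) (cantor M A r) (real (M ^ r))" using M by simp
    from uncertainty_bound_add[OF A M _ iter[of n] this]
    have ub: "uncertainty_bound (M ^ k) (cantor M A k) (R ^ n * real (M ^ r))" by (simp add: k)
    have "real (M ^ r) = (real M / \<rho>) ^ r * \<rho> ^ r" using \<rho>0 by (simp add: power_divide)
    also have "\<dots> \<le> B * \<rho> ^ r"
      unfolding B_def using \<rho>0 \<rho>M k0
      by (intro mult_right_mono power_increasing) (auto simp: r_def intro: less_imp_le mod_less_divisor)
    finally have "R ^ n * real (M ^ r) \<le> R ^ n * (B * \<rho> ^ r)"
      using R by (intro mult_left_mono) auto
    also have "\<dots> = B * \<rho> ^ k" by (simp add: k power_add power_mult[symmetric] pow[symmetric] mult_ac)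
    finally show ?thesis using uncertainty_bound_mono[OF ub] by simp
  qed
  moreover have "0 < B" using \<rho>0 M by (simp add: B_def)
  ultimately show ?thesis using \<rho>0 \<rho>M \<rho>A by blast
qed

section \<open>Fourier decay of smooth cutoffs\<close>

text \<open>
  Multiplying the sum by \<open>1 - w\<close> replaces the samples by their backward differences at step \<open>h\<close>, and each
  difference gains a factor \<open>h\<close> by the mean value theorem. Each step also extends the support by \<open>h\<close>
  to the right, which is why the function must vanish \<open>L\<close> sample points before the end. The induction
  carries the whole sequence \<open>G\<close> of derivatives, because differencing acts on all of them alike.
\<close>

lemma summation_by_parts_bound:
  fixes G :: "nat \<Rightarrow> real \<Rightarrow> real"
  assumes w: "cmod w = 1" and h: "0 \<le> h"
    and "\<And>n x. (G n has_real_derivative G (Suc n) x) (at x)"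
    and "\<And>x. x \<le> 0 \<Longrightarrow> G 0 x = 0"
    and "\<And>x. h * (real R - real L) \<le> x \<Longrightarrow> G 0 x = 0"
    and "\<And>x. \<bar>G L x\<bar> \<le> C"
  shows "cmod (1 - w) ^ L * cmod (\<Sum>m<R. of_real (G 0 (h * real m)) * w ^ m) \<le> real R * C * h ^ L"
  using assms(3-)
proof (induction L arbitrary: G C)
  case 0
  have "cmod (\<Sum>m<R. of_real (G 0 (h * real m)) * w ^ m) \<le> (\<Sum>m<R. C)"
    by (rule sum_norm_le) (use 0(4) w in \<open>simp add: norm_mult norm_power\<close>)
  thus ?case by simp
next
  case (Suc L)
  define G' where "G' n x = G n x - G n (x - h)" for n x
  have "cmod (1 - w) ^ L * cmod (\<Sum>m<R. of_real (G' 0 (h * real m)) * w ^ m) \<le> real R * (C * h) * h ^ L"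
  proof (rule Suc.IH)
    show "(G' n has_real_derivative G' (Suc n) x) (at x)" for n x
      unfolding G'_def by (auto intro!: derivative_eq_intros Suc.prems(1) DERIV_chain2[OF Suc.prems(1)])
    show "G' 0 x = 0" if "x \<le> 0" for x
      unfolding G'_def using Suc.prems(2)[of x] Suc.prems(2)[of "x - h"] that h by simp
    show "G' 0 x = 0" if "h * (real R - real L) \<le> x" for x
    proof -
      have "h * (real R - real (Suc L)) \<le> x - h" using that by (simp add: algebra_simps)
      thus ?thesis unfolding G'_def
        using Suc.prems(3)[of x] Suc.prems(3)[of "x - h"] h by simp
    qed
    show "\<bar>G' L x\<bar> \<le> C * h" for x
    proof (cases "h = 0")
      case False
      hence "x - h < x" using h by simp
      then obtain z where "G L x - G L (x - h) = (x - (x - h)) * G (Suc L) z"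
        using MVT2[OF _ Suc.prems(1)] by blast
      hence "\<bar>G' L x\<bar> = h * \<bar>G (Suc L) z\<bar>" using h by (simp add: G'_def abs_mult)
      also have "\<dots> \<le> h * C" by (rule mult_left_mono) (use Suc.prems(4) h in auto)
      finally show ?thesis by (simp add: mult.commute)
    qed (simp add: G'_def)
  qed
  also have "(\<Sum>m<R. of_real (G' 0 (h * real m)) * w ^ m)
    = (1 - w) * (\<Sum>m<R. of_real (G 0 (h * real m)) * w ^ m)"
  proof (cases R)
    case (Suc R')
    have z0: "G 0 (- h) = 0" using Suc.prems(2) h by simp
    have "h * (real R - real (Suc L)) \<le> h * real R'"
      using h Suc by (intro mult_left_mono) auto
    hence z1: "G 0 (h * real R') = 0" by (rule Suc.prems(3))
    have "(\<Sum>m<R. of_real (G 0 (h * real m - h)) * w ^ m)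
      = w * (\<Sum>m<R. of_real (G 0 (h * real m)) * w ^ m)"
      unfolding Suc
      by (subst sum.lessThan_Suc_shift, subst sum.lessThan_Suc)
         (simp add: z0 z1 sum_distrib_left algebra_simps)
    thus ?thesis by (simp add: G'_def left_diff_distrib sum_subtractf)
  qed simp
  finally show ?case by (simp add: norm_mult mult_ac)
qed

lemma smooth_cutoff_range:
  assumes "smooth_cutoff chi"
  shows "0 \<le> chi x" "chi x \<le> 1"
  using assms by (auto simp: smooth_cutoff_def)

lemma smooth_cutoff_support:
  assumes "smooth_cutoff chi"
  shows "\<exists>c>0. \<forall>x. chi x \<noteq> 0 \<longrightarrow> c \<le> x \<and> x \<le> 1 - c"
proof -
  define S where "S = closure {x. chi x \<noteq> 0}"
  have S: "S \<subseteq> {0<..<1}" using assms by (simp add: smooth_cutoff_def S_def)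
  have inS: "x \<in> S" if "chi x \<noteq> 0" for x
    unfolding S_def using that closure_subset by fastforce
  have "compact S"
    using S by (auto simp: compact_eq_bounded_closed S_def intro: bounded_subset[of "{0<..<1::real}"])
  show ?thesis
  proof (cases "S = {}")
    case True
    thus ?thesis using inS by (intro exI[of _ 1]) auto
  next
    case False
    obtain l where l: "l \<in> S" "\<forall>x\<in>S. l \<le> x" using compact_attains_inf[OF \<open>compact S\<close> False] by blast
    obtain u where u: "u \<in> S" "\<forall>x\<in>S. x \<le> u" using compact_attains_sup[OF \<open>compact S\<close> False] by blast
    have "0 < min l (1 - u)" using l u S by auto
    moreover have "min l (1 - u) \<le> x \<and> x \<le> 1 - min l (1 - u)" if "chi x \<noteq> 0" for x
      using inS[OF that] l u by fastforce
    ultimately show ?thesis by blast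
  qed
qed

lemma smooth_cutoff_derivatives:
  assumes "smooth_cutoff chi"
  shows "((deriv ^^ n) chi has_real_derivative (deriv ^^ Suc n) chi x) (at x)"
  using assms by (simp add: smooth_cutoff_def DERIV_deriv_iff_field_differentiable)

text \<open>
  All derivatives vanish off the closed support, hence are bounded by compactness of \<open>[0, 1]\<close>.
\<close>

lemma smooth_cutoff_derivative_bound:
  assumes chi: "smooth_cutoff chi"
  shows "\<exists>C. \<forall>x. \<bar>(deriv ^^ n) chi x\<bar> \<le> C"
proof -
  define S where "S = closure {x. chi x \<noteq> 0}"
  have S: "S \<subseteq> {0<..<1}" using chi by (simp add: smooth_cutoff_def S_def)
  have vanish: "(deriv ^^ n) chi x = 0" if "x \<in> - S" for x n
    using that
  proof (induction n arbitrary: x)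
    case 0
    hence "x \<notin> {x. chi x \<noteq> 0}" using closure_subset[of "{x. chi x \<noteq> 0}"] unfolding S_def by blast
    thus ?case by simp
  next
    case (Suc n)
    have "((deriv ^^ n) chi has_real_derivative 0) (at x)"
      by (rule has_field_derivative_transform_within_open[of "\<lambda>_. 0" 0 x "- S"])
         (use Suc in \<open>auto simp: S_def\<close>)
    thus ?case by (rule DERIV_unique[OF smooth_cutoff_derivatives[OF chi]])
  qed
  have "continuous_on {0..1} ((deriv ^^ n) chi)"
    by (intro continuous_at_imp_continuous_on ballI DERIV_isCont[OF smooth_cutoff_derivatives[OF chi]])
  hence "bounded ((deriv ^^ n) chi ` {0..1})"
    by (intro compact_imp_bounded compact_continuous_image) auto
  then obtain C where "\<forall>y \<in> (deriv ^^ n) chi ` {0..1}. \<bar>y\<bar> \<le> C"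
    unfolding bounded_real by blast
  hence C: "\<bar>(deriv ^^ n) chi x\<bar> \<le> C" if "x \<in> {0..1}" for x
    using that by blast
  have "\<bar>(deriv ^^ n) chi x\<bar> \<le> C" for x
  proof (cases "x \<in> {0..1}")
    case False
    hence "x \<in> - S" using S by fastforce
    thus ?thesis using vanish C[of 0] by simp
  qed (rule C)
  thus ?thesis by blast
qed

lemma smooth_cutoff_fourier_decay:
  assumes chi: "smooth_cutoff chi"
  shows "\<exists>C. \<forall>n y. 0 < n \<longrightarrow>
    cmod (1 - expi y) ^ L * cmod (\<Sum>m<n. of_real (chi (real m / real n)) * expi (real m * y))
      \<le> C * real n * (1 / real n) ^ L"
proof -
  obtain C where C: "\<And>x. \<bar>(deriv ^^ L) chi x\<bar> \<le> C"
    using smooth_cutoff_derivative_bound[OF chi] by blast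
  obtain c where c: "c > 0" "\<And>x. chi x \<noteq> 0 \<Longrightarrow> c \<le> x \<and> x \<le> 1 - c"
    using smooth_cutoff_support[OF chi] by blast
  have C0: "0 \<le> C" using C[of 0] by linarith
  have vanish: "chi x = 0" if "x \<le> 0 \<or> 1 \<le> x" for x
    using c(2)[of x] c(1) that by force
  have "cmod (1 - expi y) ^ L * cmod (\<Sum>m<n. of_real (chi (real m / real n)) * expi (real m * y))
      \<le> (1 + real L) * C * real n * (1 / real n) ^ L" if n: "0 < n" for n y
  proof -
    \<comment> \<open>Zero samples appended on the right leave room for \<open>L\<close> differences.\<close>
    have "(\<Sum>m<n. of_real (chi (real m / real n)) * expi (real m * y))
      = (\<Sum>m<n + L. of_real ((deriv ^^ 0) chi (1 / real n * real m)) * expi y ^ m)"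
      by (rule sum.mono_neutral_cong_left) (use vanish n in \<open>auto simp: expi_power\<close>)
    hence "cmod (1 - expi y) ^ L * cmod (\<Sum>m<n. of_real (chi (real m / real n)) * expi (real m * y))
      \<le> real (n + L) * C * (1 / real n) ^ L"
      using summation_by_parts_bound[of "expi y" "1 / real n" "\<lambda>n. (deriv ^^ n) chi" "n + L" L C]
        smooth_cutoff_derivatives[OF chi] vanish C n by simp
    also have "\<dots> \<le> ((1 + real L) * C * real n) * (1 / real n) ^ L"
    proof (intro mult_right_mono)
      have "real L \<le> real L * real n" using n by (simp add: mult_le_cancel_left1)
      hence "real (n + L) \<le> (1 + real L) * real n" by (simp add: algebra_simps)
      thus "real (n + L) * C \<le> (1 + real L) * C * real n"
        using mult_right_mono[OF _ C0] by (metis mult.assoc mult.commute)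
    qed simp
    finally show ?thesis .
  qed
  thus ?thesis by blast
qed

section \<open>Matrix entries of the baker map\<close>

text \<open>
  The matrix of \<open>F\<^sub>N B\<^sub>N\<close>, where \<open>n = N / M\<close>: block diagonal, with a block \<open>\<chi> F\<^sub>n \<chi>\<close> for each letter of \<open>A\<close>.
  Its symmetry is the source of the duality between an eigenvector and its Fourier transform.
\<close>

definition baker_core :: "nat set \<Rightarrow> (real \<Rightarrow> real) \<Rightarrow> nat \<Rightarrow> nat \<Rightarrow> nat \<Rightarrow> complex" where
  "baker_core A chi n p j = (if p div n = j div n \<and> j div n \<in> A then
     of_real (chi (real (p mod n) / real n)) * expi (- (real (p mod n) * real (j mod n) / real n))
       / of_real (sqrt (real n)) * of_real (chi (real (j mod n) / real n)) else 0)"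

lemma baker_core_sym: "baker_core A chi n p j = baker_core A chi n j p"
  by (auto simp: baker_core_def mult_ac)

lemma bij_betw_digits:
  "bij_betw (\<lambda>(a, m). n * a + m) ({..<M} \<times> {..<n}) {..<M * n :: nat}"
proof (rule bij_betw_imageI)
  show "inj_on (\<lambda>(a, m). n * a + m) ({..<M} \<times> {..<n})" by (rule inj_on_digits) simp
  show "(\<lambda>(a, m). n * a + m) ` ({..<M} \<times> {..<n}) = {..<M * n}"
  proof (intro equalityI subsetI)
    fix x assume "x \<in> (\<lambda>(a, m). n * a + m) ` ({..<M} \<times> {..<n})"
    then obtain a m where "a < M" "m < n" "x = n * a + m" by auto
    hence "x < n * (a + 1)" by simp
    also have "\<dots> \<le> n * M" by (rule mult_left_mono) (use \<open>a < M\<close> in auto)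
    finally show "x \<in> {..<M * n}" by (simp add: mult.commute)
  next
    fix x assume x: "x \<in> {..<M * n}"
    hence "x = n * (x div n) + x mod n" "x div n < M" "x mod n < n"
      by (auto simp: less_mult_imp_div_less intro!: mod_less_divisor gr0I)
    thus "x \<in> (\<lambda>(a, m). n * a + m) ` ({..<M} \<times> {..<n})" by force
  qed
qed

lemma sum_digits:
  fixes f :: "nat \<Rightarrow> 'b :: comm_monoid_add"
  shows "(\<Sum>p<M * n. f p) = (\<Sum>a<M. \<Sum>m<n. f (n * a + m))"
  by (subst sum.reindex_bij_betw[OF bij_betw_digits, symmetric])
     (simp add: sum.cartesian_product case_prod_unfold)

lemma mult_mat_entry:
  assumes "X \<in> carrier_mat nr n" "Y \<in> carrier_mat n nc" "i < nr" "j < nc"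
  shows "(X * Y) $$ (i, j) = (\<Sum>k<n. X $$ (i, k) * Y $$ (k, j))"
  using assms by (simp add: scalar_prod_def atLeast0LessThan)

lemma mat_adjoint_entry:
  assumes "X \<in> carrier_mat nr nc" "i < nc" "j < nr"
  shows "mat_adjoint X $$ (i, j) = cnj (X $$ (j, i))"
  using assms by (simp add: mat_adjoint_def mat_of_rows_def conjugate_complex_def)

lemma mat_adjoint_carrier':
  "X \<in> carrier_mat nr nc \<Longrightarrow> mat_adjoint X \<in> carrier_mat nc nr"
  by (auto simp: mat_adjoint_def)

lemma fourier_mat_entry:
  assumes "j < N" "l < N"
  shows "fourier_mat N $$ (j, l) = expi (- (real j * real l / real N)) / of_real (sqrt (real N))"
  using assms by (simp add: fourier_mat_def expi_def cis_conv_exp mult_ac)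

lemma baker_mat_entry:
  assumes A: "A \<subseteq> {0..<M}" and n: "0 < n" and i: "i < M * n" and j: "j < M * n"
  shows "baker_mat M A chi (M * n) $$ (i, j)
    = (\<Sum>p<M * n. expi (real i * real p / real (M * n)) / of_real (sqrt (real (M * n))) * baker_core A chi n p j)"
proof -
  define N where "N = M * n"
  have M: "0 < M" using i by (cases M) auto
  have Nn: "N div M = n" using M by (simp add: N_def)
  define E where "E p = expi (real i * real p / real N) / of_real (sqrt (real N))" for p :: nat
  define X where "X m = complex_of_real (chi (real m / real n))" for m :: nat
  define F where "F m l = expi (- (real m * real l / real n)) / of_real (sqrt (real n))" for m l :: nat
  have ij: "i < N" "j < N" using i j by (simp_all add: N_def)
  have entry: "(mat_adjoint (fourier_mat N) * mat_adjoint (block_proj_mat M N a) *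
      cutoff_mat chi (N div M) * fourier_mat (N div M) * cutoff_mat chi (N div M) *
      block_proj_mat M N a) $$ (i, j)
     = (if a = j div n then \<Sum>m<n. E (n * a + m) * (X m * F m (j mod n) * X (j mod n)) else 0)"
    if a: "a \<in> A" for a
  proof -
    have aM: "a < M" using a A by auto
    have lt: "n * a + m < N" if "m < n" for m
      using bij_betw_digits[of n M] aM that unfolding bij_betw_def N_def by force
    have cF: "fourier_mat k \<in> carrier_mat k k" for k by (simp add: fourier_mat_def)
    have cX: "cutoff_mat chi n \<in> carrier_mat n n" by (simp add: cutoff_mat_def)
    have cP: "block_proj_mat M N a \<in> carrier_mat n N" by (simp add: block_proj_mat_def Nn)
    define U1 where "U1 = mat_adjoint (fourier_mat N) * mat_adjoint (block_proj_mat M N a)"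
    have c1: "U1 \<in> carrier_mat N n" 
      unfolding U1_def by (rule mult_carrier_mat[OF mat_adjoint_carrier'[OF cF] mat_adjoint_carrier'[OF cP]])
    define U2 where "U2 = U1 * cutoff_mat chi n"
    have c2: "U2 \<in> carrier_mat N n" unfolding U2_def by (intro mult_carrier_mat[OF c1] cX)
    define U3 where "U3 = U2 * fourier_mat n"
    have c3: "U3 \<in> carrier_mat N n" unfolding U3_def by (intro mult_carrier_mat[OF c2] cF)
    define U4 where "U4 = U3 * cutoff_mat chi n"
    have c4: "U4 \<in> carrier_mat N n" unfolding U4_def by (intro mult_carrier_mat[OF c3] cX)
    have u1: "U1 $$ (i, m) = E (n * a + m)" if m: "m < n" for m
    proof -
      have "U1 $$ (i, m) = (\<Sum>k<N. mat_adjoint (fourier_mat N) $$ (i, k) * mat_adjoint (block_proj_mat M N a) $$ (k, m))"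
        unfolding U1_def by (intro mult_mat_entry[OF mat_adjoint_carrier'[OF cF] mat_adjoint_carrier'[OF cP]] ij m)
      also have "\<dots> = (\<Sum>k<N. if k = n * a + m then E k else 0)"
      proof (rule sum.cong[OF refl])
        fix k assume "k \<in> {..<N}"
        hence k: "k < N" by simp
        have "block_proj_mat M N a $$ (m, k) = (if k = n * a + m then 1 else 0)"
          using k m by (auto simp: block_proj_mat_def Nn mult.commute)
        thus "mat_adjoint (fourier_mat N) $$ (i, k) * mat_adjoint (block_proj_mat M N a) $$ (k, m)
          = (if k = n * a + m then E k else 0)"
          using k m ij by (simp add: mat_adjoint_entry[OF cF] mat_adjoint_entry[OF cP]
              fourier_mat_entry cnj_expi E_def mult.commute)
      qed
      also have "\<dots> = E (n * a + m)" using lt[OF m] by simp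
      finally show ?thesis .
    qed
    have u2: "U2 $$ (i, m) = E (n * a + m) * X m" if m: "m < n" for m
      unfolding U2_def cutoff_mat_def using c1 ij m
      by (subst mat_diag_mult_right) (auto simp: u1 X_def)
    have u3: "U3 $$ (i, l) = (\<Sum>m<n. E (n * a + m) * X m * F m l)" if l: "l < n" for l
      unfolding U3_def mult_mat_entry[OF c2 cF ij(1) l]
      by (rule sum.cong) (use l in \<open>auto simp: u2 fourier_mat_entry F_def\<close>)
    have u4: "U4 $$ (i, l) = (\<Sum>m<n. E (n * a + m) * X m * F m l) * X l" if l: "l < n" for l
      unfolding U4_def cutoff_mat_def using c3 ij l
      by (subst mat_diag_mult_right) (auto simp: u3 X_def)
    have "(U4 * block_proj_mat M N a) $$ (i, j) = (\<Sum>l<n. U4 $$ (i, l) * block_proj_mat M N a $$ (l, j))"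
      by (rule mult_mat_entry[OF c4 cP ij])
    also have "\<dots> = (\<Sum>l<n. if l = j mod n then (if a = j div n then U4 $$ (i, l) else 0) else 0)"
    proof (rule sum.cong[OF refl])
      fix l assume "l \<in> {..<n}"
      hence l: "l < n" by simp
      have "j = l + a * n \<longleftrightarrow> l = j mod n \<and> a = j div n"
        using l n by (auto simp: mult.commute)
      thus "U4 $$ (i, l) * block_proj_mat M N a $$ (l, j)
        = (if l = j mod n then (if a = j div n then U4 $$ (i, l) else 0) else 0)"
        using l ij by (simp add: block_proj_mat_def Nn)
    qed
    also have "\<dots> = (if a = j div n then U4 $$ (i, j mod n) else 0)" using n by simp
    also have "\<dots> = (if a = j div n then \<Sum>m<n. E (n * a + m) * (X m * F m (j mod n) * X (j mod n)) else 0)"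
      using n by (simp add: u4 sum_distrib_right sum_distrib_left mult_ac)
    finally show ?thesis unfolding Nn U4_def U3_def U2_def U1_def .
  qed
  have "baker_mat M A chi N $$ (i, j)
    = (\<Sum>a\<in>A. if a = j div n then \<Sum>m<n. E (n * a + m) * (X m * F m (j mod n) * X (j mod n)) else 0)"
    unfolding baker_mat_def using ij by (simp add: entry del: index_mult_mat)
  also have "\<dots> = (\<Sum>a<M. if a = j div n \<and> a \<in> A then \<Sum>m<n. E (n * a + m) * (X m * F m (j mod n) * X (j mod n)) else 0)"
    by (rule sum.mono_neutral_cong_left) (use A in auto)
  also have "\<dots> = (\<Sum>a<M. \<Sum>m<n. E (n * a + m) * baker_core A chi n (n * a + m) j)"
    by (intro sum.cong refl) (use n in \<open>auto simp: baker_core_def X_def F_def\<close>)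
  also have "\<dots> = (\<Sum>p<N. E p * baker_core A chi n p j)"
    unfolding N_def by (rule sum_digits[symmetric])
  finally show ?thesis unfolding E_def N_def .
qed

section \<open>The baker map as a contraction\<close>

definition l2 :: "nat set \<Rightarrow> (nat \<Rightarrow> complex) \<Rightarrow> real" where
  "l2 S u = L2_set (\<lambda>j. cmod (u j)) S"

lemma l2_nonneg [simp]: "0 \<le> l2 S u"
  by (simp add: l2_def)

lemma l2_squared: "(l2 S u)\<^sup>2 = (\<Sum>j\<in>S. (cmod (u j))\<^sup>2)"
  by (simp add: l2_def L2_set_def sum_nonneg)

lemma l2_le_iff: "0 \<le> c \<Longrightarrow> l2 S u \<le> c \<longleftrightarrow> (\<Sum>j\<in>S. (cmod (u j))\<^sup>2) \<le> c\<^sup>2"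
  unfolding l2_squared[symmetric] by (simp add: power2_le_iff_abs_le)

lemma l2_cong: "(\<And>j. j \<in> S \<Longrightarrow> u j = v j) \<Longrightarrow> l2 S u = l2 S v"
  unfolding l2_def by (intro L2_set_cong) auto

lemma l2_triangle: "l2 S (\<lambda>j. u j + v j) \<le> l2 S u + l2 S v"
proof -
  have "l2 S (\<lambda>j. u j + v j) \<le> L2_set (\<lambda>j. cmod (u j) + cmod (v j)) S"
    unfolding l2_def by (intro L2_set_mono norm_triangle_ineq) auto
  also have "\<dots> \<le> l2 S u + l2 S v" unfolding l2_def by (rule L2_set_triangle_ineq)
  finally show ?thesis .
qed

lemma l2_scale: "l2 S (\<lambda>j. c * u j) = cmod c * l2 S u"
  unfolding l2_def by (simp add: norm_mult L2_set_right_distrib)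

lemma l2_mono_set: "finite T \<Longrightarrow> S \<subseteq> T \<Longrightarrow> l2 S u \<le> l2 T u"
  by (subst l2_le_iff) (auto simp: l2_squared intro: sum_mono2)

lemma l2_restrict: "finite T \<Longrightarrow> S \<subseteq> T \<Longrightarrow> l2 T (\<lambda>j. if j \<in> S then u j else 0) = l2 S u"
  unfolding l2_def L2_set_def
  by (intro arg_cong[of _ _ sqrt] sum.mono_neutral_cong_right) auto

text \<open>
  A Schur-type bound; the crude factor \<open>N\<close> is harmless since it will multiply a quantity that decays
  faster than any needed power of \<open>N\<close>.
\<close>

lemma l2_small_kernel:
  assumes fin: "finite I" "finite J" and card: "card I \<le> N" "card J \<le> N"
    and b: "\<And>i j. i \<in> I \<Longrightarrow> j \<in> J \<Longrightarrow> cmod (b i j) \<le> \<eta>" and \<eta>: "0 \<le> \<eta>"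
  shows "l2 I (\<lambda>i. \<Sum>j\<in>J. b i j * f j) \<le> \<eta> * real N * l2 J f"
proof (subst l2_le_iff)
  show "0 \<le> \<eta> * real N * l2 J f" using \<eta> by simp
  have "(\<Sum>i\<in>I. (cmod (\<Sum>j\<in>J. b i j * f j))\<^sup>2) \<le> (\<Sum>i\<in>I. real N * (\<eta>\<^sup>2 * (l2 J f)\<^sup>2))"
  proof (rule sum_mono)
    fix i assume i: "i \<in> I"
    have "(cmod (\<Sum>j\<in>J. b i j * f j))\<^sup>2 \<le> real (card J) * (\<Sum>j\<in>J. (cmod (b i j * f j))\<^sup>2)"
      by (rule cmod_sum_squared_le)
    also have "\<dots> \<le> real N * (\<Sum>j\<in>J. \<eta>\<^sup>2 * (cmod (f j))\<^sup>2)"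
      using card by (intro mult_mono sum_mono sum_nonneg)
        (auto simp: norm_mult power_mult_distrib intro!: mult_right_mono power_mono b i)
    finally show "(cmod (\<Sum>j\<in>J. b i j * f j))\<^sup>2 \<le> real N * (\<eta>\<^sup>2 * (l2 J f)\<^sup>2)"
      by (simp add: l2_squared sum_distrib_left)
  qed
  also have "\<dots> \<le> real N * (real N * (\<eta>\<^sup>2 * (l2 J f)\<^sup>2))"
    using card by (simp add: mult_right_mono)
  finally show "(\<Sum>i\<in>I. (cmod (\<Sum>j\<in>J. b i j * f j))\<^sup>2) \<le> (\<eta> * real N * l2 J f)\<^sup>2"
    by (simp add: power2_eq_square mult_ac)
qed

lemma l2_inverse_fourier:
  assumes "0 < N"
  shows "l2 {..<N} (\<lambda>i. \<Sum>p<N. expi (real i * real p / real N) / of_real (sqrt (real N)) * f p) = l2 {..<N} f"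
proof -
  have "(l2 {..<N} (\<lambda>i. \<Sum>p<N. expi (real i * real p / real N) / of_real (sqrt (real N)) * f p))\<^sup>2
    = (\<Sum>i<N. (cmod (\<Sum>p<N. expi (real i * real p / real N) * f p))\<^sup>2) / real N"
    unfolding l2_squared
    by (simp add: sum_divide_distrib[symmetric] norm_divide power_divide)
  also have "\<dots> = (l2 {..<N} f)\<^sup>2"
    unfolding parseval[OF assms] l2_squared using assms by simp
  finally show ?thesis by (simp add: power2_eq_iff_nonneg)
qed

lemma parseval_neg:
  assumes "0 < N"
  shows "(\<Sum>j<N. (cmod (\<Sum>l<N. expi (- (real j * real l / real N)) * g l))\<^sup>2)
    = real N * (\<Sum>l<N. (cmod (g l))\<^sup>2)"
proof -
  have "cmod (\<Sum>l<N. expi (- (real j * real l / real N)) * g l)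
    = cmod (\<Sum>l<N. expi (real j * real l / real N) * cnj (g l))" for j
    by (subst complex_mod_cnj[symmetric]) (simp add: cnj_expi)
  thus ?thesis using parseval[OF assms, of "\<lambda>l. cnj (g l)"] by simp
qed

lemma baker_core_contraction:
  assumes n: "0 < n" and chi: "\<And>x. 0 \<le> chi x" "\<And>x. chi x \<le> 1"
  shows "l2 {..<M * n} (\<lambda>p. \<Sum>j<M * n. baker_core A chi n p j * f j) \<le> l2 {..<M * n} f"
proof (subst l2_le_iff, simp)
  define X where "X m = complex_of_real (chi (real m / real n))" for m :: nat
  have X1: "(cmod (X m))\<^sup>2 \<le> 1" for m using chi by (simp add: X_def power_le_one)
  have row: "(\<Sum>j<M * n. baker_core A chi n (n * a + m) j * f j)
     = (if a \<in> A then X m / of_real (sqrt (real n)) *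
          (\<Sum>l<n. expi (- (real m * real l / real n)) * (X l * f (n * a + l))) else 0)"
    if "a < M" "m < n" for a m
  proof -
    have "(\<Sum>j<M * n. baker_core A chi n (n * a + m) j * f j)
      = (\<Sum>a'<M. if a' = a then \<Sum>l<n. baker_core A chi n (n * a + m) (n * a + l) * f (n * a + l) else 0)"
      unfolding sum_digits by (intro sum.cong refl) (use that in \<open>auto simp: baker_core_def\<close>)
    also have "\<dots> = (\<Sum>l<n. baker_core A chi n (n * a + m) (n * a + l) * f (n * a + l))"
      using that by simp
    finally show ?thesis
      using that by (auto simp: baker_core_def X_def sum_distrib_left mult_ac intro!: sum.cong)
  qed
  have "(\<Sum>p<M * n. (cmod (\<Sum>j<M * n. baker_core A chi n p j * f j))\<^sup>2)
     = (\<Sum>a<M. \<Sum>m<n. (cmod (\<Sum>j<M * n. baker_core A chi n (n * a + m) j * f j))\<^sup>2)"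
    by (rule sum_digits)
  also have "\<dots> \<le> (\<Sum>a<M. \<Sum>l<n. (cmod (f (n * a + l)))\<^sup>2)"
  proof (rule sum_mono)
    fix a assume a: "a \<in> {..<M}"
    have "(\<Sum>m<n. (cmod (\<Sum>j<M * n. baker_core A chi n (n * a + m) j * f j))\<^sup>2)
      \<le> (\<Sum>m<n. (cmod (\<Sum>l<n. expi (- (real m * real l / real n)) * (X l * f (n * a + l))))\<^sup>2 / real n)"
    proof (rule sum_mono)
      fix m assume "m \<in> {..<n}"
      hence "(cmod (\<Sum>j<M * n. baker_core A chi n (n * a + m) j * f j))\<^sup>2
        \<le> (cmod (X m))\<^sup>2 * ((cmod (\<Sum>l<n. expi (- (real m * real l / real n)) * (X l * f (n * a + l))))\<^sup>2 / real n)"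
        using a by (simp add: row norm_mult norm_divide power_mult_distrib power_divide)
      also have "\<dots> \<le> 1 * ((cmod (\<Sum>l<n. expi (- (real m * real l / real n)) * (X l * f (n * a + l))))\<^sup>2 / real n)"
        by (rule mult_right_mono[OF X1]) simp
      finally show "(cmod (\<Sum>j<M * n. baker_core A chi n (n * a + m) j * f j))\<^sup>2
        \<le> (cmod (\<Sum>l<n. expi (- (real m * real l / real n)) * (X l * f (n * a + l))))\<^sup>2 / real n" by simp
    qed
    also have "\<dots> = (\<Sum>l<n. (cmod (X l * f (n * a + l)))\<^sup>2)"
      unfolding sum_divide_distrib[symmetric] parseval_neg[OF n] using n by simp
    also have "\<dots> \<le> (\<Sum>l<n. (cmod (f (n * a + l)))\<^sup>2)"
      by (rule sum_mono) (use X1 in \<open>auto simp: norm_mult power_mult_distrib intro: mult_left_le_one_le\<close>)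
    finally show "(\<Sum>m<n. (cmod (\<Sum>j<M * n. baker_core A chi n (n * a + m) j * f j))\<^sup>2)
      \<le> (\<Sum>l<n. (cmod (f (n * a + l)))\<^sup>2)" .
  qed
  also have "\<dots> = (l2 {..<M * n} f)\<^sup>2"
    unfolding l2_squared by (rule sum_digits[symmetric])
  finally show "(\<Sum>p<M * n. (cmod (\<Sum>j<M * n. baker_core A chi n p j * f j))\<^sup>2) \<le> (l2 {..<M * n} f)\<^sup>2" .
qed

definition baker_kernel :: "nat \<Rightarrow> nat set \<Rightarrow> (real \<Rightarrow> real) \<Rightarrow> nat \<Rightarrow> nat \<Rightarrow> nat \<Rightarrow> complex" where
  "baker_kernel M A chi n i j =
    (\<Sum>p<M * n. expi (real i * real p / real (M * n)) / of_real (sqrt (real (M * n))) * baker_core A chi n p j)"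

lemma baker_kernel_apply:
  "(\<Sum>j<M * n. baker_kernel M A chi n i j * f j)
   = (\<Sum>p<M * n. expi (real i * real p / real (M * n)) / of_real (sqrt (real (M * n)))
        * (\<Sum>j<M * n. baker_core A chi n p j * f j))"
  unfolding baker_kernel_def sum_distrib_left sum_distrib_right
  by (subst sum.swap) (simp add: mult_ac)

lemma baker_kernel_transpose_apply:
  "(\<Sum>i<M * n. baker_kernel M A chi n i j * f i)
   = (\<Sum>p<M * n. baker_core A chi n j p
        * (\<Sum>i<M * n. expi (real p * real i / real (M * n)) / of_real (sqrt (real (M * n))) * f i))"
  unfolding baker_kernel_def sum_distrib_left sum_distrib_right baker_core_sym[of A chi n j]
  by (subst sum.swap) (simp add: mult_ac)

text \<open>
  \<open>F\<^sup>*\<close> is an isometry and \<open>D\<close> a contraction; the transpose of \<open>F\<^sup>* D\<close> is \<open>D F\<^sup>*\<close> because both factors are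
  symmetric, so the next bound is equally immediate.
\<close>

lemma baker_kernel_contraction:
  assumes "0 < n" "0 < M" and "\<And>x. 0 \<le> chi x" "\<And>x. chi x \<le> 1"
  shows "l2 {..<M * n} (\<lambda>i. \<Sum>j<M * n. baker_kernel M A chi n i j * f j) \<le> l2 {..<M * n} f"
  unfolding baker_kernel_apply
  by (subst l2_inverse_fourier) (use assms baker_core_contraction in auto)

lemma baker_kernel_transpose_contraction:
  assumes "0 < n" "0 < M" and "\<And>x. 0 \<le> chi x" "\<And>x. chi x \<le> 1"
  shows "l2 {..<M * n} (\<lambda>j. \<Sum>i<M * n. baker_kernel M A chi n i j * f i) \<le> l2 {..<M * n} f"
proof -
  have "l2 {..<M * n} (\<lambda>j. \<Sum>i<M * n. baker_kernel M A chi n i j * f i)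
    \<le> l2 {..<M * n} (\<lambda>p. \<Sum>i<M * n. expi (real p * real i / real (M * n)) / of_real (sqrt (real (M * n))) * f i)"
    unfolding baker_kernel_transpose_apply by (rule baker_core_contraction) (use assms in auto)
  also have "\<dots> = l2 {..<M * n} f" by (rule l2_inverse_fourier) (use assms in simp)
  finally show ?thesis .
qed

section \<open>Decay away from the classical relation\<close>

text \<open>
  Up to a factor of modulus at most \<open>1 / n\<close>, the entry is the sum of the samples \<open>\<chi>(m / n)\<close> against
  \<open>exp (2\<pi>imy)\<close> with \<open>y = (i / M - (j mod n)) / n\<close>. The second cutoff forces \<open>(j mod n) / n\<close> into the support of
  \<open>\<chi>\<close>, so that \<open>y\<close> stays away from \<open>1\<close> and \<open>-1\<close>: distances on the circle and on the line agree up to the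
  constant \<open>c\<close>, and wrapping around never occurs. Each summation by parts then gains \<open>1 / (c W)\<close>.
\<close>

lemma baker_kernel_far:
  assumes chi: "smooth_cutoff chi" and M: "0 < M" and A: "A \<subseteq> {0..<M}"
  shows "\<exists>C\<ge>0. \<forall>n W i j. 0 < n \<longrightarrow> 0 < W \<longrightarrow> W \<le> real n \<longrightarrow> i < M * n \<longrightarrow> j < M * n \<longrightarrow>
     \<not> (j div n \<in> A \<and> \<bar>real i / real M - real (j mod n)\<bar> \<le> W) \<longrightarrow>
     cmod (baker_kernel M A chi n i j) \<le> C / W ^ L"
proof -
  obtain C where C: "\<And>n y. 0 < n \<Longrightarrow>
    cmod (1 - expi y) ^ L * cmod (\<Sum>m<n. of_real (chi (real m / real n)) * expi (real m * y))
      \<le> C * real n * (1 / real n) ^ L"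
    using smooth_cutoff_fourier_decay[OF chi] by blast
  obtain c where c: "c > 0" "\<And>x. chi x \<noteq> 0 \<Longrightarrow> c \<le> x \<and> x \<le> 1 - c"
    using smooth_cutoff_support[OF chi] by blast
  define C' where "C' = \<bar>C\<bar> / c ^ L"
  have C'0: "0 \<le> C'" using c by (simp add: C'_def)
  have "cmod (baker_kernel M A chi n i j) \<le> C' / W ^ L"
    if n: "0 < n" and W: "0 < W" "W \<le> real n" and i: "i < M * n" and j: "j < M * n"
      and far: "\<not> (j div n \<in> A \<and> \<bar>real i / real M - real (j mod n)\<bar> \<le> W)" for n W i j
  proof (cases "j div n \<in> A \<and> chi (real (j mod n) / real n) \<noteq> 0")
    case False
    hence "baker_kernel M A chi n i j = 0"
      by (auto simp: baker_kernel_def baker_core_def intro!: sum.neutral)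
    thus ?thesis using C'0 W by simp
  next
    case True
    define a where "a = j div n"
    define l where "l = j mod n"
    have aA: "a \<in> A" and nz: "chi (real l / real n) \<noteq> 0" using True by (simp_all add: a_def l_def)
    have aM: "a < M" using aA A by auto
    have ln: "l < n" using n by (simp add: l_def)
    define y where "y = (real i / real M - real l) / real n"
    define T where "T = (\<Sum>m<n. of_real (chi (real m / real n)) * expi (real m * y))"
    define const where "const = expi (real i * real a / real M) / of_real (sqrt (real (M * n)))
        * (of_real (chi (real l / real n)) / of_real (sqrt (real n)))"
    have phase: "expi (real i * real (n * a + m) / real (M * n)) * expi (- (real m * real l / real n))
      = expi (real i * real a / real M) * expi (real m * y)" for m
      unfolding expi_add[symmetric] y_def
      by (rule arg_cong[of _ _ expi]) (use n M in \<open>simp add: field_simps\<close>)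
    have "baker_kernel M A chi n i j
      = (\<Sum>a'<M. if a' = a then \<Sum>m<n. expi (real i * real (n * a + m) / real (M * n))
           / of_real (sqrt (real (M * n))) * baker_core A chi n (n * a + m) j else 0)"
      unfolding baker_kernel_def sum_digits
      by (intro sum.cong refl) (auto simp: baker_core_def a_def)
    also have "\<dots> = (\<Sum>m<n. expi (real i * real (n * a + m) / real (M * n))
           / of_real (sqrt (real (M * n))) * baker_core A chi n (n * a + m) j)"
      using aM by simp
    also have "\<dots> = (\<Sum>m<n. const * (of_real (chi (real m / real n)) * expi (real m * y)))"
    proof (intro sum.cong refl)
      fix m assume "m \<in> {..<n}"
      hence core: "baker_core A chi n (n * a + m) j = of_real (chi (real m / real n))
          * expi (- (real m * real l / real n)) / of_real (sqrt (real n)) * of_real (chi (real l / real n))"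
        using aA by (simp add: baker_core_def a_def[symmetric] l_def[symmetric])
      have "expi (real i * real (n * a + m) / real (M * n)) / of_real (sqrt (real (M * n)))
          * baker_core A chi n (n * a + m) j
        = (expi (real i * real (n * a + m) / real (M * n)) * expi (- (real m * real l / real n)))
          * (of_real (chi (real m / real n)) / of_real (sqrt (real n)) * of_real (chi (real l / real n))
             / of_real (sqrt (real (M * n))))"
        unfolding core by (simp add: mult_ac)
      thus "expi (real i * real (n * a + m) / real (M * n)) / of_real (sqrt (real (M * n)))
          * baker_core A chi n (n * a + m) j = const * (of_real (chi (real m / real n)) * expi (real m * y))"
        unfolding phase const_def by (simp add: mult_ac)
    qed
    also have "\<dots> = const * T" by (simp add: T_def sum_distrib_left)
    finally have bT: "cmod (baker_kernel M A chi n i j) = cmod const * cmod T" by (simp add: norm_mult)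
    have const: "cmod const \<le> 1 / real n"
    proof -
      have "cmod const = chi (real l / real n) / (sqrt (real (M * n)) * sqrt (real n))"
        using smooth_cutoff_range[OF chi] by (simp add: const_def norm_mult norm_divide)
      also have "\<dots> \<le> 1 / (sqrt (real n) * sqrt (real n))"
        using smooth_cutoff_range[OF chi] n M
        by (intro frac_le mult_right_mono) (auto simp: mult_le_cancel_right1)
      finally show ?thesis by simp
    qed
    have "c * (W / real n) \<le> cmod (1 - expi y)"
    proof (rule cmod_1_minus_expi_ge)
      have "W \<le> \<bar>real i / real M - real l\<bar>" using far True by (simp add: l_def)
      thus "W / real n \<le> \<bar>y\<bar>" using n by (simp add: y_def abs_divide divide_right_mono)
      have lc: "c \<le> real l / real n" "real l / real n \<le> 1 - c" using c(2)[OF nz] by auto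
      have ypl: "y = real i / real (M * n) - real l / real n"
        by (simp add: y_def diff_divide_distrib)
      have "real i < real (M * n)" using i unfolding of_nat_less_iff .
      hence "real i / real (M * n) \<le> 1" "0 \<le> real i / real (M * n)" by (auto simp: divide_le_eq)
      thus "\<bar>y\<bar> \<le> 1 - c" using lc ypl unfolding abs_le_iff by linarith
    qed (use c W n in auto)
    hence "(c * (W / real n)) ^ L * cmod T \<le> cmod (1 - expi y) ^ L * cmod T"
      using c W by (intro mult_right_mono power_mono) auto
    also have "\<dots> \<le> C * real n * (1 / real n) ^ L" unfolding T_def by (rule C[OF n])
    also have "\<dots> \<le> \<bar>C\<bar> * real n * (1 / real n) ^ L" by (intro mult_right_mono) auto
    finally have "(c * W) ^ L * cmod T \<le> \<bar>C\<bar> * real n"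
      using n by (simp add: power_mult_distrib power_divide divide_le_cancel field_simps)
    hence T: "cmod T \<le> \<bar>C\<bar> * real n / (c * W) ^ L"
      using c W by (simp add: pos_le_divide_eq mult.commute)
    have "cmod const * cmod T \<le> 1 / real n * (\<bar>C\<bar> * real n / (c * W) ^ L)"
      by (intro mult_mono const T) auto
    also have "\<dots> = C' / W ^ L" using n by (simp add: C'_def power_mult_distrib)
    finally show ?thesis unfolding bT .
  qed
  thus ?thesis using C'0 by blast
qed

section \<open>Uncertainty bounds for neighbourhoods\<close>

text \<open>
  Translating either variable multiplies the kernel by unimodular factors depending on one variable
  only, and these do not change the norm. Shifts are integers of either sign and do not wrap around.
\<close>

lemma uncertainty_bound_translates:
  fixes s t :: int
  assumes ub: "uncertainty_bound N C R" and R: "0 \<le> R" and fin: "finite C" and N: "0 < N"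
    and D: "\<And>j. j \<in> D \<Longrightarrow> \<exists>c\<in>C. int j = int c + t"
    and E: "\<And>l. l \<in> E \<Longrightarrow> \<exists>c\<in>C. int l = int c + s"
  shows "(\<Sum>j\<in>D. (cmod (\<Sum>l\<in>E. expi (real j * real l / real N) * w l))\<^sup>2)
    \<le> R * (\<Sum>l\<in>E. (cmod (w l))\<^sup>2)"
proof -
  define \<sigma> where "\<sigma> l = nat (int l - s)" for l
  define \<tau> where "\<tau> l = nat (int l - t)" for l
  have \<sigma>: "\<sigma> l \<in> C" "int (\<sigma> l) = int l - s" if "l \<in> E" for l
    using E[OF that] by (auto simp: \<sigma>_def)
  have \<tau>: "\<tau> j \<in> C" "int (\<tau> j) = int j - t" if "j \<in> D" for j
    using D[OF that] by (auto simp: \<tau>_def)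
  have inj\<sigma>: "inj_on \<sigma> E" 
    by (rule inj_on_inverseI[of _ "\<lambda>c. nat (int c + s)"]) (simp add: \<sigma>(2))
  have inj\<tau>: "inj_on \<tau> D" 
    by (rule inj_on_inverseI[of _ "\<lambda>c. nat (int c + t)"]) (simp add: \<tau>(2))
  have unshift: "nat (int (\<sigma> l) + s) = l" if "l \<in> E" for l using \<sigma>(2)[OF that] by simp
  define g where "g c = (if c \<in> \<sigma> ` E then expi (of_int t * real c / real N) * w (nat (int c + s)) else 0)" for c
  have inner: "cmod (\<Sum>l\<in>E. expi (real j * real l / real N) * w l)
      = cmod (\<Sum>c\<in>C. expi (real (\<tau> j) * real c / real N) * g c)" if j: "j \<in> D" for j
  proof -
    have "(\<Sum>c\<in>C. expi (real (\<tau> j) * real c / real N) * g c)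
      = (\<Sum>c\<in>\<sigma> ` E. expi (real (\<tau> j) * real c / real N) * g c)"
      by (rule sum.mono_neutral_right) (use fin \<sigma> in \<open>auto simp: g_def\<close>)
    also have "\<dots> = (\<Sum>l\<in>E. expi (real (\<tau> j) * real (\<sigma> l) / real N) * (expi (of_int t * real (\<sigma> l) / real N) * w l))"
      by (subst sum.reindex[OF inj\<sigma>]) (simp add: g_def unshift)
    finally have *: "(\<Sum>c\<in>C. expi (real (\<tau> j) * real c / real N) * g c) = \<dots>" .
    have phase: "expi (real j * real l / real N) = expi (real j * of_int s / real N)
        * (expi (real (\<tau> j) * real (\<sigma> l) / real N) * expi (of_int t * real (\<sigma> l) / real N))" if l: "l \<in> E" for l
    proof -
      have "real l = real (\<sigma> l) + of_int s" using \<sigma>(2)[OF l] by linarith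
      moreover have "real j = real (\<tau> j) + of_int t" using \<tau>(2)[OF j] by linarith
      ultimately have "real j * real l
          = real j * of_int s + (real (\<tau> j) * real (\<sigma> l) + of_int t * real (\<sigma> l))"
        by (simp add: algebra_simps)
      thus ?thesis unfolding expi_add[symmetric] by (simp add: add_divide_distrib)
    qed
    have "(\<Sum>l\<in>E. expi (real j * real l / real N) * w l) = expi (real j * of_int s / real N)
      * (\<Sum>c\<in>C. expi (real (\<tau> j) * real c / real N) * g c)"
      unfolding * sum_distrib_left by (rule sum.cong[OF refl], subst phase) (simp_all only: mult_ac)
    thus ?thesis by (simp add: norm_mult)
  qed
  have "(\<Sum>j\<in>D. (cmod (\<Sum>l\<in>E. expi (real j * real l / real N) * w l))\<^sup>2)
    = (\<Sum>c\<in>\<tau> ` D. (cmod (\<Sum>c'\<in>C. expi (real c * real c' / real N) * g c'))\<^sup>2)"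
    by (subst sum.reindex[OF inj\<tau>]) (simp add: inner)
  also have "\<dots> \<le> (\<Sum>c\<in>C. (cmod (\<Sum>c'\<in>C. expi (real c * real c' / real N) * g c'))\<^sup>2)"
    by (rule sum_mono2) (use fin \<tau> in auto)
  also have "\<dots> \<le> R * (\<Sum>c\<in>C. (cmod (g c))\<^sup>2)"
    using ub unfolding uncertainty_bound_def by blast
  also have "(\<Sum>c\<in>C. (cmod (g c))\<^sup>2) = (\<Sum>c\<in>\<sigma> ` E. (cmod (g c))\<^sup>2)"
    by (rule sum.mono_neutral_right) (use fin \<sigma> in \<open>auto simp: g_def\<close>)
  also have "\<dots> = (\<Sum>l\<in>E. (cmod (w l))\<^sup>2)"
    by (subst sum.reindex[OF inj\<sigma>]) (simp add: g_def unshift norm_mult)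
  finally show ?thesis .
qed

text \<open>
  The neighbourhood is a disjoint union of pieces of \<open>2 W + 1\<close> translates. The output splits
  orthogonally over the pieces and the input costs Cauchy-Schwarz, giving one factor \<open>2 W + 1\<close> each.
\<close>

lemma uncertainty_bound_neighbourhood:
  fixes W :: nat
  assumes ub: "uncertainty_bound N C R" and R: "0 \<le> R" and fin: "finite C" and N: "0 < N"
    and finX: "finite X" and X: "\<And>x. x \<in> X \<Longrightarrow> \<exists>c\<in>C. \<bar>int x - int c\<bar> \<le> int W"
  shows "(\<Sum>j\<in>X. (cmod (\<Sum>l\<in>X. expi (real j * real l / real N) * w l))\<^sup>2)
    \<le> (2 * real W + 1)\<^sup>2 * R * (\<Sum>l\<in>X. (cmod (w l))\<^sup>2)"
proof -
  define T where "T = {- int W..int W}"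
  have cardT: "real (card T) = 2 * real W + 1" by (simp add: T_def)
  have finT: "finite T" by (simp add: T_def)
  obtain c where c: "\<And>x. x \<in> X \<Longrightarrow> c x \<in> C \<and> \<bar>int x - int (c x)\<bar> \<le> int W"
    using X by metis
  \<comment> \<open>Choosing one nearby point for each element makes the pieces disjoint.\<close>
  define sh where "sh x = int x - int (c x)" for x
  have shT: "sh ` X \<subseteq> T" using c by (force simp: sh_def T_def abs_le_iff)
  define P where "P t = {x \<in> X. sh x = t}" for t
  have P: "\<exists>c\<in>C. int x = int c + t" if "x \<in> P t" for x t
    using that c[of x] by (auto simp: P_def sh_def intro!: bexI[of _ "c x"])
  have group: "(\<Sum>x\<in>X. f x) = (\<Sum>t\<in>T. \<Sum>x\<in>P t. f x)" for f :: "nat \<Rightarrow> 'b :: comm_monoid_add"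
    unfolding P_def by (rule sum.group[OF finX finT shT, symmetric])
  define e where "e j l = expi (real j * real l / real N)" for j l :: nat
  have "(\<Sum>j\<in>X. (cmod (\<Sum>l\<in>X. e j l * w l))\<^sup>2)
    \<le> (\<Sum>j\<in>X. real (card T) * (\<Sum>s\<in>T. (cmod (\<Sum>l\<in>P s. e j l * w l))\<^sup>2))"
    by (intro sum_mono) (subst group, rule cmod_sum_squared_le)
  also have "\<dots> = real (card T) * (\<Sum>s\<in>T. \<Sum>j\<in>X. (cmod (\<Sum>l\<in>P s. e j l * w l))\<^sup>2)"
    by (subst sum.swap) (simp add: sum_distrib_left)
  also have "\<dots> \<le> real (card T) * (\<Sum>s\<in>T. real (card T) * (R * (\<Sum>l\<in>P s. (cmod (w l))\<^sup>2)))"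
  proof (intro mult_left_mono sum_mono)
    fix s
    have "(\<Sum>j\<in>X. (cmod (\<Sum>l\<in>P s. e j l * w l))\<^sup>2) = (\<Sum>t\<in>T. \<Sum>j\<in>P t. (cmod (\<Sum>l\<in>P s. e j l * w l))\<^sup>2)"
      by (rule group)
    also have "\<dots> \<le> (\<Sum>t\<in>T. R * (\<Sum>l\<in>P s. (cmod (w l))\<^sup>2))"
      unfolding e_def by (intro sum_mono uncertainty_bound_translates[OF ub R fin N P P])
    finally show "(\<Sum>j\<in>X. (cmod (\<Sum>l\<in>P s. e j l * w l))\<^sup>2) \<le> real (card T) * (R * (\<Sum>l\<in>P s. (cmod (w l))\<^sup>2))"
      by simp
  qed simp
  also have "\<dots> = (real (card T))\<^sup>2 * R * (\<Sum>s\<in>T. \<Sum>l\<in>P s. (cmod (w l))\<^sup>2)"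
    by (simp add: sum_distrib_left power2_eq_square mult_ac)
  also have "(\<Sum>s\<in>T. \<Sum>l\<in>P s. (cmod (w l))\<^sup>2) = (\<Sum>l\<in>X. (cmod (w l))\<^sup>2)"
    by (rule group[symmetric])
  finally show ?thesis unfolding cardT e_def .
qed

section \<open>Points trapped for a long time\<close>

text \<open>
  The points from which a chain of \<open>t\<close> non-negligible transitions starts: those that stay in the blocks
  of \<open>A\<close> for \<open>t\<close> steps of the expanding map \<open>j \<mapsto> M j\<close>, up to an error \<open>W\<close> after contraction by \<open>M\<close>.
\<close>

primrec trapped :: "nat \<Rightarrow> nat set \<Rightarrow> nat \<Rightarrow> real \<Rightarrow> nat \<Rightarrow> nat set" where
  "trapped M A n W 0 = {..<M * n}"
| "trapped M A n W (Suc t) = {j \<in> {..<M * n}. j div n \<in> A \<and>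
     (\<exists>i\<in>trapped M A n W t. \<bar>real i / real M - real (j mod n)\<bar> \<le> W)}"

lemma trapped_subset: "trapped M A n W t \<subseteq> {..<M * n}"
  by (cases t) auto

text \<open>
  One step backwards contracts the accumulated error by \<open>M \<ge> 2\<close> and adds \<open>W\<close>, so it never exceeds
  \<open>2 W\<close>. The additional \<open>M\<^sup>K\<close> is the length of the intervals that the \<open>t\<close> leading digits determine.
\<close>

lemma trapped_near_cantor:
  assumes M: "2 \<le> M" and W: "0 \<le> W"
  shows "t + K = Suc k \<Longrightarrow> j \<in> trapped M A (M ^ k) W t \<Longrightarrow>
     \<exists>c\<in>cantor M A t. \<bar>real j - real c * real M ^ K\<bar> \<le> 2 * W + real M ^ K"
proof (induction t arbitrary: K j)
  case 0
  hence "real j < real (M * M ^ k)" unfolding of_nat_less_iff by simp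
  thus ?case using 0 W by simp
next
  case (Suc t)
  define a l where "a = j div M ^ k" and "l = j mod M ^ k"
  have jal: "j = M ^ k * a + l" by (simp add: a_def l_def)
  from Suc.prems(2) obtain i where a: "a \<in> A" and i: "i \<in> trapped M A (M ^ k) W t"
    and il: "\<bar>real i / real M - real l\<bar> \<le> W" by (auto simp: a_def l_def)
  have "t + Suc K = Suc k" using Suc.prems(1) by simp
  from Suc.IH[OF this i] obtain c where c: "c \<in> cantor M A t"
    and ic: "\<bar>real i - real c * real M ^ Suc K\<bar> \<le> 2 * W + real M ^ Suc K" by blast
  have k: "k = t + K" using Suc.prems(1) by simp
  have c': "M ^ t * a + c \<in> cantor M A (Suc t)" using a c by force
  have "real i / real M - real c * real M ^ K = (real i - real c * real M ^ Suc K) / real M"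
    using M by (simp add: field_simps)
  hence "\<bar>real i / real M - real c * real M ^ K\<bar> \<le> (2 * W + real M ^ Suc K) / real M"
    using ic M by (simp add: divide_right_mono)
  also have "\<dots> = 2 * W / real M + real M ^ K" using M by (simp add: add_divide_distrib)
  also have "2 * W / real M \<le> W"
  proof -
    have "2 * W \<le> real M * W" by (rule mult_right_mono) (use M W in auto)
    thus ?thesis using M by (simp add: divide_le_eq mult.commute)
  qed
  finally have "\<bar>real l - real c * real M ^ K\<bar> \<le> 2 * W + real M ^ K" using il by linarith
  moreover have "real j - real (M ^ t * a + c) * real M ^ K = real l - real c * real M ^ K"
    by (simp add: jal k power_add algebra_simps)
  ultimately show ?case using c' by (intro bexI[of _ "M ^ t * a + c"]) simp_all
qed

text \<open>
  Completing the \<open>t\<close> leading digits by \<open>K\<close> arbitrary digits from \<open>A\<close> moves the point by less than \<open>M\<^sup>K\<close>,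
  in addition to the \<open>3 M\<^sup>K\<close> already lost.
\<close>

lemma trapped_near_full_cantor:
  assumes A: "A \<subseteq> {0..<M}" "A \<noteq> {}" and M: "2 \<le> M" and tK: "t + K = Suc k"
    and j: "j \<in> trapped M A (M ^ k) (real M ^ K) t"
  shows "\<exists>c\<in>cantor M A (Suc k). \<bar>int j - int c\<bar> \<le> int (4 * M ^ K)"
proof -
  obtain c where c: "c \<in> cantor M A t"
    and jc: "\<bar>real j - real c * real M ^ K\<bar> \<le> 2 * real M ^ K + real M ^ K"
    using trapped_near_cantor[OF M _ tK j] by auto
  obtain z where z: "z \<in> cantor M A K" using cantor_nonempty[OF A(2)] by blast
  have "(\<lambda>(a, b). M ^ K * a + b) (c, z) \<in> cantor M A (K + t)"
    unfolding bij_betw_imp_surj_on[OF cantor_split[OF A(1), of K t], symmetric]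
    using z c by (intro imageI) simp
  hence mem: "M ^ K * c + z \<in> cantor M A (Suc k)" using tK by (simp add: add.commute)
  have "real z < real (M ^ K)" unfolding of_nat_less_iff by (rule cantor_less[OF A(1) z])
  moreover have "real (M ^ K * c + z) = real c * real M ^ K + real z" by simp
  ultimately have "\<bar>real j - real (M ^ K * c + z)\<bar> \<le> 4 * real M ^ K"
    using jc unfolding of_nat_power by linarith
  hence "real_of_int \<bar>int j - int (M ^ K * c + z)\<bar> \<le> real_of_int (int (4 * M ^ K))" by simp
  thus ?thesis using mem unfolding of_int_le_iff by blast
qed

section \<open>Localization of eigenvectors\<close>

text \<open>
  Restricting the equation \<open>\<mu> u = b u\<close> to \<open>X t\<close> involves, up to negligible entries, only the values of \<open>u\<close>
  on \<open>X (t + 1)\<close>. As \<open>b\<close> is a contraction, each step loses only the factor \<open>|\<mu>|\<close>.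
\<close>

lemma right_eigenvector_localizes:
  assumes finN: "\<And>t. X t \<subseteq> {..<N}"
    and far: "\<And>t i j. i \<in> X t \<Longrightarrow> j \<in> {..<N} - X (Suc t) \<Longrightarrow> cmod (b i j) \<le> \<eta>" and \<eta>: "0 \<le> \<eta>"
    and X0: "X 0 = {..<N}"
    and contr: "\<And>f. l2 {..<N} (\<lambda>i. \<Sum>j<N. b i j * f j) \<le> l2 {..<N} f"
    and ev: "\<And>i. i < N \<Longrightarrow> (\<Sum>j<N. b i j * u j) = \<mu> * u i" and \<mu>: "cmod \<mu> \<le> 1"
  shows "cmod \<mu> ^ t * l2 {..<N} u \<le> l2 (X t) u + real t * (\<eta> * real N * l2 {..<N} u)"
proof (induction t)
  case 0
  show ?case by (simp add: X0)
next
  case (Suc t)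
  have fin: "finite (X t)" for t using finN finite_subset by blast
  define f where "f j = (if j \<in> X (Suc t) then u j else 0)" for j
  have "cmod \<mu> * l2 (X t) u = l2 (X t) (\<lambda>i. \<Sum>j<N. b i j * u j)"
    unfolding l2_scale[symmetric] by (rule l2_cong, subst ev) (use finN in auto)
  also have "\<dots> = l2 (X t) (\<lambda>i. (\<Sum>j<N. b i j * f j) + (\<Sum>j\<in>{..<N} - X (Suc t). b i j * u j))"
  proof (rule l2_cong)
    fix i
    have "(\<Sum>j<N. b i j * f j) = (\<Sum>j\<in>X (Suc t). b i j * u j)"
      by (rule sum.mono_neutral_cong_right) (use finN in \<open>auto simp: f_def\<close>)
    thus "(\<Sum>j<N. b i j * u j) = (\<Sum>j<N. b i j * f j) + (\<Sum>j\<in>{..<N} - X (Suc t). b i j * u j)"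
      using sum.subset_diff[OF finN[of "Suc t"], of "\<lambda>j. b i j * u j"] by (simp add: add.commute)
  qed
  also have "\<dots> \<le> l2 (X t) (\<lambda>i. \<Sum>j<N. b i j * f j)
      + l2 (X t) (\<lambda>i. \<Sum>j\<in>{..<N} - X (Suc t). b i j * u j)"
    by (rule l2_triangle)
  also have "l2 (X t) (\<lambda>i. \<Sum>j<N. b i j * f j) \<le> l2 (X (Suc t)) u"
  proof -
    have "l2 (X t) (\<lambda>i. \<Sum>j<N. b i j * f j) \<le> l2 {..<N} (\<lambda>i. \<Sum>j<N. b i j * f j)"
      by (rule l2_mono_set) (use finN in auto)
    also have "\<dots> \<le> l2 {..<N} f" by (rule contr)
    also have "\<dots> = l2 (X (Suc t)) u" unfolding f_def by (rule l2_restrict) (use finN in auto)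
    finally show ?thesis .
  qed
  also have "l2 (X t) (\<lambda>i. \<Sum>j\<in>{..<N} - X (Suc t). b i j * u j) \<le> \<eta> * real N * l2 {..<N} u"
  proof -
    have "l2 (X t) (\<lambda>i. \<Sum>j\<in>{..<N} - X (Suc t). b i j * u j) \<le> \<eta> * real N * l2 ({..<N} - X (Suc t)) u"
    proof (rule l2_small_kernel[OF fin _ _ _ far \<eta>])
      show "card (X t) \<le> N" using card_mono[OF _ finN[of t]] by simp
      show "card ({..<N} - X (Suc t)) \<le> N" using card_mono[of "{..<N}" "{..<N} - X (Suc t)"] by simp
    qed auto
    also have "\<dots> \<le> \<eta> * real N * l2 {..<N} u"
      by (intro mult_left_mono l2_mono_set) (use \<eta> in auto)
    finally show ?thesis .
  qed
  finally have step: "cmod \<mu> * l2 (X t) u \<le> l2 (X (Suc t)) u + \<eta> * real N * l2 {..<N} u" by simp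
  have "cmod \<mu> ^ Suc t * l2 {..<N} u = cmod \<mu> * (cmod \<mu> ^ t * l2 {..<N} u)" by simp
  also have "\<dots> \<le> cmod \<mu> * (l2 (X t) u + real t * (\<eta> * real N * l2 {..<N} u))"
    by (rule mult_left_mono[OF Suc.IH]) simp
  also have "\<dots> \<le> cmod \<mu> * l2 (X t) u + real t * (\<eta> * real N * l2 {..<N} u)"
    unfolding distrib_left using \<eta> \<mu> by (intro add_left_mono mult_left_le_one_le) auto
  finally show ?case using step by (simp add: distrib_right)
qed

text \<open>
  The transposed version: outside \<open>X (t + 1)\<close> the values of \<open>w\<close> come, up to negligible entries, from its
  values outside \<open>X t\<close>. As \<open>X 0\<close> is everything, \<open>w\<close> is small outside every \<open>X t\<close> as long as \<open>|\<mu>|\<^sup>t\<close> is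
  not itself tiny.
\<close>

lemma left_eigenvector_localizes:
  assumes finN: "\<And>t. X t \<subseteq> {..<N}"
    and far: "\<And>t i j. i \<in> X t \<Longrightarrow> j \<in> {..<N} - X (Suc t) \<Longrightarrow> cmod (b i j) \<le> \<eta>" and \<eta>: "0 \<le> \<eta>"
    and X0: "X 0 = {..<N}"
    and contr: "\<And>f. l2 {..<N} (\<lambda>j. \<Sum>i<N. b i j * f i) \<le> l2 {..<N} f"
    and ev: "\<And>j. j < N \<Longrightarrow> (\<Sum>i<N. b i j * w i) = \<mu> * w j" and \<mu>: "cmod \<mu> \<le> 1"
  shows "cmod \<mu> ^ t * l2 ({..<N} - X t) w \<le> real t * (\<eta> * real N * l2 {..<N} w)"
proof (induction t)
  case 0
  show ?case by (simp add: X0 l2_def)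
next
  case (Suc t)
  have fin: "finite (X t)" for t using finN finite_subset by blast
  let ?Y = "{..<N} - X (Suc t)"
  define f where "f i = (if i \<in> {..<N} - X t then w i else 0)" for i
  have "cmod \<mu> * l2 ?Y w = l2 ?Y (\<lambda>j. \<Sum>i<N. b i j * w i)"
    unfolding l2_scale[symmetric] by (rule l2_cong, subst ev) auto
  also have "\<dots> = l2 ?Y (\<lambda>j. (\<Sum>i<N. b i j * f i) + (\<Sum>i\<in>X t. b i j * w i))"
  proof (rule l2_cong)
    fix j
    have "(\<Sum>i<N. b i j * f i) = (\<Sum>i\<in>{..<N} - X t. b i j * w i)"
      by (rule sum.mono_neutral_cong_right) (auto simp: f_def)
    thus "(\<Sum>i<N. b i j * w i) = (\<Sum>i<N. b i j * f i) + (\<Sum>i\<in>X t. b i j * w i)"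
      using sum.subset_diff[OF finN[of t], of "\<lambda>i. b i j * w i"] by simp
  qed
  also have "\<dots> \<le> l2 ?Y (\<lambda>j. \<Sum>i<N. b i j * f i) + l2 ?Y (\<lambda>j. \<Sum>i\<in>X t. b i j * w i)"
    by (rule l2_triangle)
  also have "l2 ?Y (\<lambda>j. \<Sum>i<N. b i j * f i) \<le> l2 ({..<N} - X t) w"
  proof -
    have "l2 ?Y (\<lambda>j. \<Sum>i<N. b i j * f i) \<le> l2 {..<N} (\<lambda>j. \<Sum>i<N. b i j * f i)"
      by (rule l2_mono_set) auto
    also have "\<dots> \<le> l2 {..<N} f" by (rule contr)
    also have "\<dots> = l2 ({..<N} - X t) w" unfolding f_def by (rule l2_restrict) auto
    finally show ?thesis .
  qed
  also have "l2 ?Y (\<lambda>j. \<Sum>i\<in>X t. b i j * w i) \<le> \<eta> * real N * l2 {..<N} w"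
  proof -
    have "l2 ?Y (\<lambda>j. \<Sum>i\<in>X t. b i j * w i) \<le> \<eta> * real N * l2 (X t) w"
    proof (rule l2_small_kernel[OF _ fin _ _ far \<eta>])
      show "card (X t) \<le> N" using card_mono[OF _ finN[of t]] by simp
      show "card ?Y \<le> N" using card_mono[of "{..<N}" ?Y] by simp
    qed auto
    also have "\<dots> \<le> \<eta> * real N * l2 {..<N} w"
      by (intro mult_left_mono l2_mono_set) (use \<eta> finN in auto)
    finally show ?thesis .
  qed
  finally have step: "cmod \<mu> * l2 ?Y w \<le> l2 ({..<N} - X t) w + \<eta> * real N * l2 {..<N} w" by simp
  have "cmod \<mu> ^ Suc t * l2 ?Y w = cmod \<mu> ^ t * (cmod \<mu> * l2 ?Y w)" by simp
  also have "\<dots> \<le> cmod \<mu> ^ t * (l2 ({..<N} - X t) w + \<eta> * real N * l2 {..<N} w)"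
    by (rule mult_left_mono[OF step]) simp
  also have "\<dots> \<le> cmod \<mu> ^ t * l2 ({..<N} - X t) w + \<eta> * real N * l2 {..<N} w"
    unfolding distrib_left using \<eta> \<mu>
    by (intro add_left_mono mult_left_le_one_le) (auto simp: power_le_one)
  finally show ?case using Suc.IH by (simp add: distrib_right)
qed

section \<open>The spectral bound\<close>

lemma eigenvalue_imp_kernel_eigenvector:
  assumes A: "A \<subseteq> {0..<M}" and n: "0 < n" and ev: "eigenvalue (baker_mat M A chi (M * n)) \<mu>"
  shows "\<exists>u. (\<exists>i<M * n. u i \<noteq> 0) \<and> (\<forall>i<M * n. (\<Sum>j<M * n. baker_kernel M A chi n i j * u j) = \<mu> * u i)"
proof -
  define N where "N = M * n"
  have dim: "dim_row (baker_mat M A chi N) = N" "dim_col (baker_mat M A chi N) = N"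
    by (simp_all add: baker_mat_def)
  obtain v where v: "v \<in> carrier_vec N" "v \<noteq> 0\<^sub>v N"
    and eq: "baker_mat M A chi N *\<^sub>v v = \<mu> \<cdot>\<^sub>v v"
    using ev unfolding eigenvalue_def eigenvector_def N_def[symmetric] dim by blast
  have dv: "dim_vec v = N" using v by simp
  have "\<exists>i<N. vec_index v i \<noteq> 0"
  proof (rule ccontr)
    assume "\<not> ?thesis"
    hence "v = 0\<^sub>v N" using dv by (intro eq_vecI) auto
    thus False using v by simp
  qed
  moreover have "(\<Sum>j<N. baker_kernel M A chi n i j * vec_index v j) = \<mu> * vec_index v i" if i: "i < N" for i
  proof -
    have "vec_index (baker_mat M A chi N *\<^sub>v v) i = (\<Sum>j<N. baker_mat M A chi N $$ (i, j) * vec_index v j)"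
      using i dim dv by (simp add: scalar_prod_def atLeast0LessThan)
    also have "\<dots> = (\<Sum>j<N. baker_kernel M A chi n i j * vec_index v j)"
      by (intro sum.cong refl)
         (use baker_mat_entry[OF A n, of i _ chi] i in \<open>simp add: N_def baker_kernel_def\<close>)
    finally show ?thesis using i dv by (simp add: eq)
  qed
  ultimately show ?thesis unfolding N_def by blast
qed

text \<open>
  Here \<open>E\<close> is the kernel of \<open>F\<^sup>*\<close> and \<open>w = F u\<close>. On the trapped set \<open>X\<close>, the vector \<open>u = E w\<close> splits into the contribution
  of \<open>w\<close> on \<open>X\<close>, which the uncertainty bound controls, and of \<open>w\<close> off \<open>X\<close>, which is small. Using both
  localizations at the same time \<open>t\<close> loses only \<open>|\<mu>|\<^sup>t\<close> on the left; the operator bound for the power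
  \<open>2t\<close> obtained from the two localizations would only give half the exponent.
\<close>

lemma eigenvalue_inequality:
  fixes \<eta> :: real
  assumes A: "A \<subseteq> {0..<M}" "A \<noteq> {}" and M: "2 \<le> M" and chi: "smooth_cutoff chi"
    and tK: "t + K = Suc k"
    and far: "\<And>i j. i < M * M ^ k \<Longrightarrow> j < M * M ^ k \<Longrightarrow>
        \<not> (j div M ^ k \<in> A \<and> \<bar>real i / real M - real (j mod M ^ k)\<bar> \<le> real M ^ K) \<Longrightarrow>
        cmod (baker_kernel M A chi (M ^ k) i j) \<le> \<eta>"
    and \<eta>: "0 \<le> \<eta>"
    and ub: "uncertainty_bound (M ^ Suc k) (cantor M A (Suc k)) R" and R: "0 \<le> R"
    and ev: "eigenvalue (baker_mat M A chi (M ^ Suc k)) \<mu>" and \<mu>0: "\<mu> \<noteq> 0"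
  shows "cmod \<mu> \<le> 1"
    and "cmod \<mu> ^ t \<le> (8 * real M ^ K + 1) * sqrt (R / real M ^ Suc k)
       + real t * (\<eta> * real M ^ Suc k) + real t * (\<eta> * real M ^ Suc k) / cmod \<mu> ^ t"
proof -
  define n where "n = M ^ k"
  define N where "N = M * n"
  have n: "0 < n" and M0: "0 < M" using M by (simp_all add: n_def)
  have N: "0 < N" using n M0 by (simp add: N_def)
  have NSuc: "N = M ^ Suc k" by (simp add: N_def n_def)
  define b where "b = baker_kernel M A chi n"
  define X where "X = trapped M A n (real M ^ K)"
  obtain u where u0: "\<exists>i<N. u i \<noteq> 0" and u: "\<And>i. i < N \<Longrightarrow> (\<Sum>j<N. b i j * u j) = \<mu> * u i"
    using eigenvalue_imp_kernel_eigenvector[OF A(1) n, of chi \<mu>] ev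
    unfolding N_def[symmetric] NSuc[symmetric] b_def by blast
  have U: "0 < l2 {..<N} u"
  proof -
    have "0 < (l2 {..<N} u)\<^sup>2" unfolding l2_squared using u0 by (auto intro: sum_pos2)
    thus ?thesis by (simp add: zero_less_power2 less_le)
  qed
  have contr: "l2 {..<N} (\<lambda>i. \<Sum>j<N. b i j * f j) \<le> l2 {..<N} f"
    and contr': "l2 {..<N} (\<lambda>j. \<Sum>i<N. b i j * f i) \<le> l2 {..<N} f" for f
    unfolding b_def N_def
    using baker_kernel_contraction[OF n M0, of chi A f] baker_kernel_transpose_contraction[OF n M0, of chi A f]
      smooth_cutoff_range[OF chi] by simp_all
  have "cmod \<mu> * l2 {..<N} u = l2 {..<N} (\<lambda>i. \<Sum>j<N. b i j * u j)"
    unfolding l2_scale[symmetric] by (rule l2_cong, subst u) auto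
  also have "\<dots> \<le> 1 * l2 {..<N} u" using contr by simp
  finally show \<mu>1: "cmod \<mu> \<le> 1" using U by simp

  define E where "E i p = expi (real i * real p / real N) / of_real (sqrt (real N))" for i p :: nat
  have E_sym: "E i p = E p i" for i p by (simp add: E_def mult.commute)
  \<comment> \<open>Dividing \<open>D u\<close> by \<open>\<mu>\<close> gives the Fourier transform of \<open>u\<close> without inverting \<open>F\<^sup>*\<close>.\<close>
  define w where "w p = (\<Sum>j<N. baker_core A chi n p j * u j) / \<mu>" for p
  have Du: "(\<Sum>j<N. baker_core A chi n p j * u j) = \<mu> * w p" for p
    using \<mu>0 by (simp add: w_def)
  have uw: "u i = (\<Sum>p<N. E i p * w p)" if i: "i < N" for i
  proof -
    have "\<mu> * u i = (\<Sum>p<N. E i p * (\<Sum>j<N. baker_core A chi n p j * u j))"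
      using u[OF i] baker_kernel_apply[of M A chi n i u] by (simp add: E_def N_def b_def)
    also have "\<dots> = \<mu> * (\<Sum>p<N. E i p * w p)"
      unfolding Du by (simp add: sum_distrib_left mult_ac)
    finally show ?thesis using \<mu>0 by simp
  qed
  have wev: "(\<Sum>i<N. b i j * w i) = \<mu> * w j" for j
  proof -
    have "(\<Sum>i<N. b i j * w i) = (\<Sum>p<N. baker_core A chi n j p * (\<Sum>i<N. E p i * w i))"
      using baker_kernel_transpose_apply[of M A chi n j w] by (simp add: E_def N_def b_def)
    also have "\<dots> = (\<Sum>p<N. baker_core A chi n j p * u p)"
      by (intro sum.cong refl) (simp add: uw)
    also have "\<dots> = \<mu> * w j" by (rule Du)
    finally show ?thesis .
  qed
  have l2_E: "l2 {..<N} (\<lambda>i. \<Sum>p<N. E i p * f p) = l2 {..<N} f" for f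
    unfolding E_def by (rule l2_inverse_fourier[OF N])
  have wU: "l2 {..<N} w = l2 {..<N} u"
    unfolding l2_E[of w, symmetric] by (rule l2_cong) (simp add: uw)

  have Xsub: "X s \<subseteq> {..<N}" for s unfolding X_def N_def by (rule trapped_subset)
  have far': "cmod (b i j) \<le> \<eta>" if i: "i \<in> X s" and j: "j \<in> {..<N} - X (Suc s)" for s i j
    unfolding b_def n_def
  proof (rule far)
    show "i < M * M ^ k" "j < M * M ^ k"
      using i j Xsub[of s] by (auto simp: N_def n_def)
    show "\<not> (j div M ^ k \<in> A \<and> \<bar>real i / real M - real (j mod M ^ k)\<bar> \<le> real M ^ K)"
      using i j by (auto simp: X_def n_def N_def)
  qed
  have X0: "X 0 = {..<N}" by (simp add: X_def N_def)
  have right: "cmod \<mu> ^ t * l2 {..<N} u \<le> l2 (X t) u + real t * (\<eta> * real N * l2 {..<N} u)"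
    by (rule right_eigenvector_localizes[where X = X and b = b and u = u, OF Xsub far' \<eta> X0 contr u \<mu>1])
  have left: "cmod \<mu> ^ t * l2 ({..<N} - X t) w \<le> real t * (\<eta> * real N * l2 {..<N} w)"
    by (rule left_eigenvector_localizes[where X = X and b = b and w = w, OF Xsub far' \<eta> X0 contr' wev \<mu>1])

  have "l2 (X t) u = l2 (X t) (\<lambda>i. (\<Sum>p\<in>X t. E i p * w p) + (\<Sum>p\<in>{..<N} - X t. E i p * w p))"
  proof (rule l2_cong)
    fix i assume "i \<in> X t"
    hence "i < N" using Xsub by auto
    thus "u i = (\<Sum>p\<in>X t. E i p * w p) + (\<Sum>p\<in>{..<N} - X t. E i p * w p)"
      using sum.subset_diff[OF Xsub[of t], of "\<lambda>p. E i p * w p"] by (simp add: uw add.commute)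
  qed
  also have "\<dots> \<le> l2 (X t) (\<lambda>i. \<Sum>p\<in>X t. E i p * w p) + l2 (X t) (\<lambda>i. \<Sum>p\<in>{..<N} - X t. E i p * w p)"
    by (rule l2_triangle)
  also have "l2 (X t) (\<lambda>i. \<Sum>p\<in>{..<N} - X t. E i p * w p) \<le> l2 ({..<N} - X t) w"
  proof -
    define f where "f p = (if p \<in> {..<N} - X t then w p else 0)" for p
    have "(\<Sum>p\<in>{..<N} - X t. E i p * w p) = (\<Sum>p<N. E i p * f p)" for i
      by (rule sum.mono_neutral_cong_left) (auto simp: f_def)
    hence "l2 (X t) (\<lambda>i. \<Sum>p\<in>{..<N} - X t. E i p * w p) \<le> l2 {..<N} (\<lambda>i. \<Sum>p<N. E i p * f p)"
      using l2_mono_set[OF _ Xsub[of t]] by simp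
    also have "\<dots> = l2 {..<N} f" by (rule l2_E)
    also have "\<dots> = l2 ({..<N} - X t) w" unfolding f_def by (rule l2_restrict) auto
    finally show ?thesis .
  qed
  also have "l2 (X t) (\<lambda>i. \<Sum>p\<in>X t. E i p * w p)
    \<le> (8 * real M ^ K + 1) * sqrt (R / real N) * l2 {..<N} w"
  proof (subst l2_le_iff)
    show "0 \<le> (8 * real M ^ K + 1) * sqrt (R / real N) * l2 {..<N} w" using R by simp
    have near: "\<exists>c\<in>cantor M A (Suc k). \<bar>int x - int c\<bar> \<le> int (4 * M ^ K)" if "x \<in> X t" for x
      using trapped_near_full_cantor[OF A M tK] that by (simp add: X_def n_def)
    have "(\<Sum>i\<in>X t. (cmod (\<Sum>p\<in>X t. E i p * w p))\<^sup>2)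
      = (\<Sum>i\<in>X t. (cmod (\<Sum>p\<in>X t. expi (real i * real p / real N) * w p))\<^sup>2) / real N"
      unfolding E_def by (simp add: sum_divide_distrib[symmetric] norm_divide power_divide)
    also have "\<dots> \<le> (2 * real (4 * M ^ K) + 1)\<^sup>2 * R * (\<Sum>p\<in>X t. (cmod (w p))\<^sup>2) / real N"
      by (intro divide_right_mono uncertainty_bound_neighbourhood[OF ub[folded NSuc] R finite_cantor[OF A(1)] N])
         (use near finite_subset[OF Xsub] in auto)
    also have "\<dots> \<le> (2 * real (4 * M ^ K) + 1)\<^sup>2 * R * (\<Sum>p<N. (cmod (w p))\<^sup>2) / real N"
      by (intro divide_right_mono mult_left_mono sum_mono2) (use Xsub R in auto)
    also have "\<dots> = ((8 * real M ^ K + 1) * sqrt (R / real N) * l2 {..<N} w)\<^sup>2"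
      using R by (simp add: power_mult_distrib l2_squared)
    finally show "(\<Sum>i\<in>X t. (cmod (\<Sum>p\<in>X t. E i p * w p))\<^sup>2)
      \<le> ((8 * real M ^ K + 1) * sqrt (R / real N) * l2 {..<N} w)\<^sup>2" .
  qed
  also have "l2 ({..<N} - X t) w \<le> real t * (\<eta> * real N * l2 {..<N} w) / cmod \<mu> ^ t"
    using left \<mu>0 by (simp add: pos_le_divide_eq mult.commute)
  finally have "l2 (X t) u \<le> (8 * real M ^ K + 1) * sqrt (R / real N) * l2 {..<N} u
      + real t * (\<eta> * real N * l2 {..<N} u) / cmod \<mu> ^ t"
    unfolding wU by simp
  with right have "cmod \<mu> ^ t * l2 {..<N} u \<le> (8 * real M ^ K + 1) * sqrt (R / real N) * l2 {..<N} u
      + real t * (\<eta> * real N * l2 {..<N} u) / cmod \<mu> ^ t + real t * (\<eta> * real N * l2 {..<N} u)"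
    by linarith
  also have "\<dots> = ((8 * real M ^ K + 1) * sqrt (R / real N)
       + real t * (\<eta> * real N) + real t * (\<eta> * real N) / cmod \<mu> ^ t) * l2 {..<N} u"
    by (simp add: algebra_simps)
  finally have "cmod \<mu> ^ t \<le> (8 * real M ^ K + 1) * sqrt (R / real N)
       + real t * (\<eta> * real N) + real t * (\<eta> * real N) / cmod \<mu> ^ t"
    using U by (simp only: mult_le_cancel_right_pos)
  thus "cmod \<mu> ^ t \<le> (8 * real M ^ K + 1) * sqrt (R / real M ^ Suc k)
       + real t * (\<eta> * real M ^ Suc k) + real t * (\<eta> * real M ^ Suc k) / cmod \<mu> ^ t"
    unfolding NSuc of_nat_power .
qed

text \<open>
  For a putative eigenvalue above \<open>s\<close>, divide the eigenvalue inequality by \<open>s\<^sup>k\<close>. With \<open>K = k div q + 1\<close> the main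
  term becomes a constant times \<open>(\<theta> \<sigma> / s)\<^sup>k\<close>, where \<open>\<theta> = M\<^bsup>1/q\<^esup>\<close> accounts for the thickening \<open>M\<^sup>K\<close> and
  \<open>\<sigma> = sqrt (\<rho> / M)\<close> for the uncertainty bound. The other terms are made small by \<open>4 q\<close> summations by
  parts: these give \<open>\<eta> \<le> C M\<^bsup>-4k\<^esup>\<close>, which outweighs the factors \<open>M\<^sup>k\<close> (from the size of the matrix)
  and \<open>s\<^bsup>-2k\<^esup> \<le> M\<^bsup>2k\<^esup>\<close> (from both divisions) and leaves \<open>M\<^bsup>-k\<^esup>\<close>.
\<close>

lemma spectral_radius_eventually_le:
  assumes A: "A \<subseteq> {0..<M}" "A \<noteq> {}" and M: "2 \<le> M" and chi: "smooth_cutoff chi"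
    and B: "0 < B" and \<rho>: "0 < \<rho>"
    and ub: "\<And>k. uncertainty_bound (M ^ k) (cantor M A k) (B * \<rho> ^ k)"
    and s: "1 / real M \<le> s" "s \<le> 1"
    and q: "2 \<le> q" and gap: "root q (real M) * sqrt (\<rho> / real M) < s"
  shows "eventually (\<lambda>k. spectral_radius (baker_mat M A chi (M ^ k)) \<le> s) sequentially"
proof -
  define m where "m = real M"
  have m: "2 \<le> m" using M by (simp add: m_def)
  define \<theta> where "\<theta> = root q m"
  define \<sigma> where "\<sigma> = sqrt (\<rho> / m)"
  have \<theta>1: "1 \<le> \<theta>" using m q by (simp add: \<theta>_def)
  have \<theta>q: "\<theta> ^ q = m" using m q by (simp add: \<theta>_def)
  have \<sigma>0: "0 < \<sigma>" using \<rho> m by (simp add: \<sigma>_def)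
  have "0 < 1 / m" using m by simp
  hence s0: "0 < s" using s(1) unfolding m_def by linarith
  obtain C where C0: "0 \<le> C" and C: "\<And>n W i j. 0 < n \<Longrightarrow> 0 < W \<Longrightarrow> W \<le> real n \<Longrightarrow>
      i < M * n \<Longrightarrow> j < M * n \<Longrightarrow>
      \<not> (j div n \<in> A \<and> \<bar>real i / real M - real (j mod n)\<bar> \<le> W) \<Longrightarrow>
      cmod (baker_kernel M A chi n i j) \<le> C / W ^ (4 * q)"
    using baker_kernel_far[OF chi _ A(1), of "4 * q"] M by auto
  \<comment> \<open>The right-hand side that results after division by \<open>s\<^sup>k\<close>; the factor 9 comes from \<open>8 m\<^sup>K + 1 \<le> 9 m\<^sup>K\<close>.\<close>
  define g where "g k = 9 * m * sqrt B * (\<theta> * \<sigma> / s) ^ k + 2 * C * (real k * (1 / m) ^ k)" for k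
  have lim1: "(\<lambda>k. (\<theta> * \<sigma> / s) ^ k) \<longlonglongrightarrow> 0"
  proof (rule LIMSEQ_realpow_zero)
    show "\<theta> * \<sigma> / s < 1" using gap s0 by (simp add: \<theta>_def \<sigma>_def m_def divide_less_eq)
    show "0 \<le> \<theta> * \<sigma> / s" using \<theta>1 \<sigma>0 s0 by simp
  qed
  have lim2: "(\<lambda>k. real k * (1 / m) ^ k) \<longlonglongrightarrow> 0"
    using powser_times_n_limit_0[of "1 / m"] m by simp
  have "g \<longlonglongrightarrow> 9 * m * sqrt B * 0 + 2 * C * 0"
    unfolding g_def by (intro tendsto_intros lim1 lim2)
  hence "g \<longlonglongrightarrow> 0" by simp
  hence "eventually (\<lambda>k. g k < 1) sequentially" by (rule order_tendstoD(2)) simp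
  moreover have "eventually (\<lambda>k. 4 \<le> k) sequentially" by (rule eventually_ge_at_top)
  ultimately show ?thesis
  proof eventually_elim
    case (elim k')
    obtain k where k': "k' = Suc k" using elim by (cases k') auto
    define K where "K = k' div q + 1"
    define t where "t = k' - K"
    have "k' div q \<le> k' div 2" by (rule div_le_mono2) (use q in auto)
    hence Kk: "K \<le> k" using elim k' by (simp add: K_def)
    hence tK: "t + K = Suc k" by (simp add: t_def k')
    have tk': "t \<le> k'" by (simp add: t_def)
    define \<eta> where "\<eta> = C / (m ^ K) ^ (4 * q)"
    have \<eta>0: "0 \<le> \<eta>" using C0 m by (simp add: \<eta>_def)
    have far: "cmod (baker_kernel M A chi (M ^ k) i j) \<le> \<eta>"
      if "i < M * M ^ k" "j < M * M ^ k"
        "\<not> (j div M ^ k \<in> A \<and> \<bar>real i / real M - real (j mod M ^ k)\<bar> \<le> real M ^ K)" for i j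
      unfolding \<eta>_def m_def
      by (rule C) (use that M Kk in \<open>auto intro: power_increasing\<close>)
    have dim: "baker_mat M A chi (M ^ k') \<in> carrier_mat (M ^ k') (M ^ k')" by (simp add: baker_mat_def)
    have "spectral_radius (baker_mat M A chi (M ^ k')) \<in> norm ` spectrum (baker_mat M A chi (M ^ k'))"
      by (rule spectral_radius_mem_max[OF dim]) (use M in simp)
    then obtain \<mu> where ev: "eigenvalue (baker_mat M A chi (M ^ Suc k)) \<mu>"
      and r: "spectral_radius (baker_mat M A chi (M ^ k')) = cmod \<mu>"
      by (auto simp: spectrum_def k')
    show ?case
    proof (rule ccontr)
      assume "\<not> ?case"
      hence s\<mu>: "s < cmod \<mu>" using r by simp
      hence \<mu>0: "\<mu> \<noteq> 0" using s0 by auto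
      have R0: "0 \<le> B * \<rho> ^ Suc k" using B \<rho> by simp
      note main = eigenvalue_inequality[OF A M chi tK far \<eta>0 ub R0 ev \<mu>0, folded k' m_def]
      have small: "real t * (\<eta> * m ^ k') \<le> real k' * C * (1 / m) ^ (3 * k')"
      proof -
        have "k' = q * (k' div q) + k' mod q" by simp
        moreover have "k' mod q < q" using q by (intro mod_less_divisor) auto
        ultimately have "k' \<le> q * K" unfolding K_def distrib_left by linarith
        hence "m ^ (4 * k') \<le> m ^ (K * (4 * q))" using m by (intro power_increasing) (auto simp: mult.commute)
        hence "\<eta> \<le> C / m ^ (4 * k')" unfolding \<eta>_def power_mult[symmetric]
          using C0 m by (intro divide_left_mono) auto
        hence "real t * (\<eta> * m ^ k') \<le> real k' * (C / m ^ (4 * k') * m ^ k')"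
          using tk' \<eta>0 m by (intro mult_mono mult_right_mono) auto
        also have "m ^ (4 * k') = m ^ (3 * k') * m ^ k'" by (simp add: power_add[symmetric])
        finally show ?thesis using m by (simp add: power_divide)
      qed
      have mK: "8 * m ^ K + 1 \<le> 9 * m * \<theta> ^ k'"
      proof -
        have "m ^ K = m * \<theta> ^ (q * (k' div q))" by (simp add: K_def \<theta>q power_mult)
        also have "\<dots> \<le> m * \<theta> ^ k'" using m \<theta>1 by (intro mult_left_mono power_increasing) auto
        finally have "m ^ K \<le> m * \<theta> ^ k'" .
        moreover have "1 \<le> m ^ K" using m by simp
        ultimately show ?thesis by linarith
      qed
      have sq: "sqrt (B * \<rho> ^ k' / m ^ k') = sqrt B * \<sigma> ^ k'"
        using B \<rho> m by (simp add: \<sigma>_def real_sqrt_mult real_sqrt_divide real_sqrt_power power_divide)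
      have sk: "s ^ k' \<le> cmod \<mu> ^ t"
      proof -
        have "s ^ k' \<le> s ^ t" using s0 s tk' by (intro power_decreasing) auto
        also have "\<dots> \<le> cmod \<mu> ^ t" using s0 s\<mu> by (intro power_mono) auto
        finally show ?thesis .
      qed
      have sm: "(1 / m) ^ k' \<le> s ^ k'" using s m by (intro power_mono) (auto simp: m_def)
      define z where "z = (1 / m) ^ k'"
      have z: "0 < z" "z \<le> s ^ k'" using sm m by (simp_all add: z_def)
      have small': "real t * (\<eta> * m ^ k') \<le> real k' * C * z ^ 3"
        using small by (simp add: z_def power_mult[symmetric] mult.commute)
      have z1: "z \<le> 1" using m by (simp add: z_def power_le_one)
      have "real t * (\<eta> * m ^ k') / cmod \<mu> ^ t \<le> (real k' * C * z ^ 3) / z"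
        by (rule frac_le) (use small' sk z C0 in auto)
      also have "\<dots> = real k' * C * z\<^sup>2" using z by (simp add: power2_eq_square power3_eq_cube)
      finally have t3: "real t * (\<eta> * m ^ k') / cmod \<mu> ^ t \<le> real k' * C * z\<^sup>2" .
      have "z ^ 3 \<le> z\<^sup>2" using z z1 by (intro power_decreasing) auto
      hence t2: "real t * (\<eta> * m ^ k') \<le> real k' * C * z\<^sup>2"
        using small' C0 by (meson mult_left_mono mult_nonneg_nonneg of_nat_0_le_iff order_trans)
      have t1: "(8 * m ^ K + 1) * sqrt (B * \<rho> ^ k' / m ^ k') \<le> 9 * m * \<theta> ^ k' * (sqrt B * \<sigma> ^ k')"
        unfolding sq using mK B \<sigma>0 by (intro mult_right_mono) auto
      have "s ^ k' \<le> 9 * m * \<theta> ^ k' * (sqrt B * \<sigma> ^ k') + 2 * (real k' * C * z\<^sup>2)"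
        using sk main(2) t1 t2 t3 by linarith
      also have "\<dots> \<le> 9 * m * \<theta> ^ k' * (sqrt B * \<sigma> ^ k') + 2 * (real k' * C * (z * s ^ k'))"
        using z C0 by (intro add_left_mono mult_left_mono) (auto simp: power2_eq_square)
      also have "\<dots> = g k' * s ^ k'"
        unfolding g_def z_def[symmetric]
        using s0 by (simp add: power_divide power_mult_distrib algebra_simps)
      finally have "1 \<le> g k'" using s0 by simp
      thus False using elim by simp
    qed
  qed
qed

theorem theorem1:
  fixes M :: nat and A :: "nat set" and \<delta> :: real
  assumes "A \<subseteq> {0..<M}"
    and "1 < card A" and "card A < M"
    and "\<delta> = ln (real (card A)) / ln (real M)"
  shows "\<delta> \<in> {0<..<1} \<and>
    (\<exists>\<beta>::real. \<beta> > max 0 (1 / 2 - \<delta>) \<and>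
      (\<forall>chi. smooth_cutoff chi \<longrightarrow>
        limsup (\<lambda>k. ereal (spectral_radius (baker_mat M A chi (M ^ k))))
          \<le> ereal (real M powr (- \<beta>))))"
proof -
  define m where "m = real M"
  have M: "2 \<le> M" and m: "2 \<le> m" using assms by (simp_all add: m_def)
  have lnm: "0 < ln m" using m by simp
  have \<delta>: "0 < \<delta>" "\<delta> < 1" using assms lnm by (simp_all add: m_def)
  have card_powr: "real (card A) = m powr \<delta>"
    using assms lnm by (simp add: powr_def m_def)
  obtain \<rho> B where \<rho>: "0 < \<rho>" "\<rho> < m" "\<rho> < (real (card A))\<^sup>2" and B: "0 < B"
    and ub: "\<And>k. uncertainty_bound (M ^ k) (cantor M A k) (B * \<rho> ^ k)"
    using fractal_uncertainty_principle[OF assms(1-3)] unfolding m_def by blast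
  define \<beta>0 where "\<beta>0 = (1 - log m \<rho>) / 2"
  have "log m \<rho> < 1" using \<rho> m by (simp add: log_less_one_cancel_iff)
  moreover have "log m \<rho> < 2 * \<delta>"
  proof -
    have "\<rho> < m powr (2 * \<delta>)"
      using \<rho>(3) unfolding card_powr by (simp add: powr_add[symmetric] power2_eq_square)
    thus ?thesis using \<rho> m by (simp add: log_less_iff)
  qed
  ultimately have \<beta>0: "max 0 (1/2 - \<delta>) < \<beta>0" by (auto simp: \<beta>0_def max_def)
  \<comment> \<open>Any \<open>\<beta>\<close> strictly between the two exponents works; \<open>\<beta> < 1\<close> ensures \<open>1 / M \<le> M\<^bsup>-\<beta>\<^esup>\<close>.\<close>
  define \<beta> where "\<beta> = (max 0 (1/2 - \<delta>) + min \<beta>0 1) / 2"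
  have \<beta>: "max 0 (1/2 - \<delta>) < \<beta>" "\<beta> < \<beta>0" "\<beta> < 1" using \<beta>0 \<delta> by (auto simp: \<beta>_def)
  obtain q0 :: nat where q0: "1 / (\<beta>0 - \<beta>) < real q0" using reals_Archimedean2 by blast
  define q where "q = max 2 q0"
  have q: "2 \<le> q" by (simp add: q_def)
  have "1 / (\<beta>0 - \<beta>) < real q" using q0 by (simp add: q_def)
  hence qb: "1 / real q < \<beta>0 - \<beta>" using \<beta> q by (simp add: field_simps)
  have rootm: "root q m = m powr (1 / real q)" using m q by (simp add: root_powr_inverse)
  have "\<rho> / m = m powr (- 2 * \<beta>0)"
  proof -
    have "- 2 * \<beta>0 = log m \<rho> + (-1)" by (simp add: \<beta>0_def)
    hence "m powr (- 2 * \<beta>0) = m powr (log m \<rho>) * m powr (-1)"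
      by (simp only: powr_add)
    also have "\<dots> = \<rho> / m" using \<rho> m by (simp add: powr_minus divide_inverse)
    finally show ?thesis by simp
  qed
  hence sqrtm: "sqrt (\<rho> / m) = m powr (- \<beta>0)"
    using m by (simp add: powr_half_sqrt[symmetric] powr_powr)
  have "root q m * sqrt (\<rho> / m) = m powr (1 / real q - \<beta>0)"
    unfolding rootm sqrtm by (simp add: powr_add[symmetric])
  also have "\<dots> < m powr (- \<beta>)" using qb m by (intro powr_less_mono) auto
  finally have gap: "root q m * sqrt (\<rho> / m) < m powr (- \<beta>)" .
  have "m powr (-1) \<le> m powr (- \<beta>)" using \<beta> m by (intro powr_mono) auto
  hence s1: "1 / m \<le> m powr (- \<beta>)" using m by (simp add: powr_minus divide_inverse)
  have s2: "m powr (- \<beta>) \<le> 1" using \<beta> m powr_mono[of "- \<beta>" 0 m] by simp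
  have "limsup (\<lambda>k. ereal (spectral_radius (baker_mat M A chi (M ^ k)))) \<le> ereal (real M powr (- \<beta>))"
    if chi: "smooth_cutoff chi" for chi
  proof (rule Limsup_bounded)
    have "A \<noteq> {}" using assms by auto
    from spectral_radius_eventually_le[OF assms(1) this M chi B \<rho>(1) ub s1[unfolded m_def] s2[unfolded m_def]
        q gap[unfolded m_def]]
    show "eventually (\<lambda>k. ereal (spectral_radius (baker_mat M A chi (M ^ k))) \<le> ereal (real M powr (- \<beta>))) sequentially"
      by simp
  qed
  thus ?thesis using \<delta> \<beta>(1) by auto
qed

end
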